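(* Let $0\le\alpha<1$, let $P_\bullet$ be the size-biased presentation of limit frequencies of a Gibbs$(\alpha)$ partition with weights $(V_{k:n})$, let $p_{k:n}:=V_{k+1:n+1}/V_{k:n}$ for $1\le k\le n$, and let $X_1,X_2,\ldots$ be a random sample from $P_\bullet$. For positive integers $m_1,\ldots,m_r$ let $$h_\alpha(m_1,\ldots,m_r):=\frac{m_1-\alpha}{(m_1-\alpha)+\cdots+(m_r-\alpha)}.$$ Given that the value-ordered frequencies of $X_1,\ldots,X_n$ are $N^{X\uparrow}_{\bullet:n}=(n_1,\ldots,n_k)$, the value-ordered frequencies of $X_1,\ldots,X_{n+1}$ are obtained as follows: (a) for each $j\in\{1,\ldots,k+1\}$, the conditional probability that $X_{n+1}$ is a value not present among $X_1,\ldots,X_n$ and has rank $j$ among the $k+1$ distinct values in $X_1,\ldots,X_{n+1}$ (so that a $1$ is inserted into $(n_1,\ldots,n_k)$ at the $j$th of $k+1$ possible places, giving $(n_1,\ldots,n_{j-1},1,n_j,\ldots,n_k)$) is $$p_{k:n}\,h_\alpha(1,n_j,\ldots,n_k)\prod_{i=1}^{j-1}\bigl[1-h_\alpha(1,n_i,\ldots,n_k)\bigr];$$ (b) for each $j\in\{1,\ldots,k\}$, the conditional probability that $X_{n+1}$ equals the $j$th smallest of the $k$ distinct values in $X_1,\ldots,X_n$ (so that $n_j$ is incremented by $1$) is $$(1-p_{k:n})\,h_\alpha(n_j+1,n_{j+1},\ldots,n_k)\prod_{i=1}^{j-1}\bigl[1-h_\alpha(n_i+1,n_{i+1},\ldo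ts,n_k)\bigr].$$
   Context: Gibbs$(\alpha)$ partition: an exchangeable random partition of $\mathbb{N}=\{1,2,\ldots\}$ is a sequence $(\Pi_n)$ of random partitions of $[n]=\{1,\ldots,n\}$, with $\Pi_m$ the restriction of $\Pi_n$ to $[m]$ for $m<n$, such that for each $n$ and each partition $\{C_1,\ldots,C_k\}$ of $[n]$, $\mathbb{P}(\Pi_n=\{C_1,\ldots,C_k\})=p(\#C_1,\ldots,\#C_k)$ for some symmetric function $p$ (the EPPF). It is a Gibbs$(\alpha)$ partition with weights $(V_{k:n})$ if $p(n_1,\ldots,n_k)=V_{k:n}\prod_{i=1}^k(1-\alpha)_{n_i-1}$ with $n=\sum_i n_i$ and $(x)_m=\Gamma(x+m)/\Gamma(x)$, where the $V_{k:n}$, $1\le k\le n$, are positive and satisfy $V_{k:n}=(n-k\alpha)V_{k:n+1}+V_{k+1:n+1}$ for all $1\le k\le n$. The size-biased presentation of its limit frequencies is $P_\bullet=(P_1,P_2,\ldots)$ where $P_j$ is the almost sure limit as $n\to\infty$ of $1/n$ times the size of the $j$th cluster of $\Pi_n$ in order of appearance (order of least elements). It is assumed that $P_j>0$ for all $j$ and $\sum_jP_j=1$ almost surely. A random sample from $P_\bullet$ is a sequence which, conditionally given $P_\bullet$, is i.i.d. with $\mathbb{P}(X_i=j\mid P_\bullet)=P_j$, $j\ge1$. The value-ordered frequencies $N^{X\uparrow}_{\bullet:n}$ of $X_1,\ldots,X_n$ list, in increasing order of the distinct values occurring among $X_1,\ldots,X_n$, the numbers of times these values occur among $X_1,\ldots,X_n$.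 Empty products equal $1$; for $j=k+1$, $h_\alpha(1,n_j,\ldots,n_k)$ means $h_\alpha(1)=1$. *)

theory Defs
  imports "HOL-Probability.Probability" "HOL-Library.Disjoint_Sets"
begin

definition restrict_partition :: "nat \<Rightarrow> nat set set \<Rightarrow> nat set set" where
  "restrict_partition m \<pi> = (\<lambda>C. C \<inter> {1..m}) ` \<pi> - {{}}"

definition random_partition :: "'a measure \<Rightarrow> (nat \<Rightarrow> 'a \<Rightarrow> nat set set) \<Rightarrow> bool" where
  "random_partition M R \<longleftrightarrow>
     (\<forall>n\<ge>1. R n \<in> measurable M (count_space {\<pi>. partition_on {1..n} \<pi>})) \<and>
     (\<forall>m n. 1 \<le> m \<longrightarrow> m < n \<longrightarrow> (\<forall>\<omega>\<in>space M. R m \<omega> = restrict_partition m (R n \<omega>)))"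

definition compositions :: "nat list set" where
  "compositions = {ns. ns \<noteq> [] \<and> (\<forall>m\<in>set ns. 1 \<le> m)}"

(* An exchangeable partition probability function is only evaluated at compositions,
   so symmetry is only required there. *)
definition exchangeable_partition_eppf ::
  "'a measure \<Rightarrow> (nat \<Rightarrow> 'a \<Rightarrow> nat set set) \<Rightarrow> (nat list \<Rightarrow> real) \<Rightarrow> bool" where
  "exchangeable_partition_eppf M R p \<longleftrightarrow>
     random_partition M R \<and>
     (\<forall>ns\<in>compositions. \<forall>ns'. mset ns' = mset ns \<longrightarrow> p ns' = p ns) \<and>
     (\<forall>n\<ge>1. \<forall>Cs. distinct Cs \<longrightarrow> partition_on {1..n} (set Cs) \<longrightarrow>
        \<P>(\<omega> in M. R n \<omega> = set Cs) = p (map card Cs))"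

(* V k n stands for the weight written V_{k:n}. *)
definition gibbs_weights :: "real \<Rightarrow> (nat \<Rightarrow> nat \<Rightarrow> real) \<Rightarrow> bool" where
  "gibbs_weights \<alpha> V \<longleftrightarrow>
     (\<forall>n. \<forall>k\<in>{1..n}. V k n > 0 \<and>
        V k n = (real n - real k * \<alpha>) * V k (n + 1) + V (k + 1) (n + 1))"

(* pochhammer x m = Gamma (x + m) / Gamma x for x > 0; see pochhammer_Gamma. *)
definition gibbs_partition ::
  "'a measure \<Rightarrow> real \<Rightarrow> (nat \<Rightarrow> nat \<Rightarrow> real) \<Rightarrow> (nat \<Rightarrow> 'a \<Rightarrow> nat set set) \<Rightarrow> bool" where
  "gibbs_partition M \<alpha> V R \<longleftrightarrow>
     gibbs_weights \<alpha> V \<and>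
     (\<exists>p. exchangeable_partition_eppf M R p \<and>
        (\<forall>ns\<in>compositions.
           p ns = V (length ns) (sum_list ns) * (\<Prod>m\<leftarrow>ns. pochhammer (1 - \<alpha>) (m - 1))))"

(* Distinct blocks of a partition have distinct minima, so listing the blocks by their
   minima is the order of appearance. The size is 0 if there are fewer than j clusters. *)
definition cluster_size :: "nat \<Rightarrow> nat set set \<Rightarrow> nat" where
  "cluster_size j \<pi> =
     (let Cs = sorted_key_list_of_set Min \<pi>
      in if 1 \<le> j \<and> j \<le> length Cs then card (Cs ! (j - 1)) else 0)"

(* P is indexed from 1; P 0 is irrelevant. *)
definition size_biased_frequencies ::
  "'a measure \<Rightarrow> (nat \<Rightarrow> 'a \<Rightarrow> nat set set) \<Rightarrow> (nat \<Rightarrow> 'a \<Rightarrow> real) \<Rightarrow> bool" where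
  "size_biased_frequencies M R P \<longleftrightarrow>
     (\<forall>j\<ge>1. P j \<in> borel_measurable M) \<and>
     (\<forall>j\<ge>1. AE \<omega> in M. (\<lambda>n. real (cluster_size j (R n \<omega>)) / real n) \<longlonglongrightarrow> P j \<omega>)"

definition proper_frequencies :: "'a measure \<Rightarrow> (nat \<Rightarrow> 'a \<Rightarrow> real) \<Rightarrow> bool" where
  "proper_frequencies M P \<longleftrightarrow>
     (AE \<omega> in M. (\<forall>j\<ge>1. P j \<omega> > 0) \<and> (\<lambda>j. P (Suc j) \<omega>) sums 1)"

definition sigma_generated :: "'a measure \<Rightarrow> (nat \<Rightarrow> 'a \<Rightarrow> real) \<Rightarrow> 'a measure" where
  "sigma_generated M P =
     vimage_algebra (space M) (\<lambda>\<omega>. \<lambda>j\<in>{1..}. P j \<omega>) (\<Pi>\<^sub>M j\<in>{1..}. borel)"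

definition cond_prob_given :: "'a measure \<Rightarrow> 'a measure \<Rightarrow> 'a set \<Rightarrow> 'a \<Rightarrow> real" where
  "cond_prob_given M F A = real_cond_exp M F (indicator A)"

(* The second and third conjuncts say that, conditionally given P, the X i are
   independent with common distribution (P 1, P 2, ...). *)
definition random_sample_from ::
  "'a measure \<Rightarrow> (nat \<Rightarrow> 'a \<Rightarrow> real) \<Rightarrow> (nat \<Rightarrow> 'a \<Rightarrow> nat) \<Rightarrow> bool" where
  "random_sample_from M P X \<longleftrightarrow>
     (\<forall>i\<ge>1. X i \<in> measurable M (count_space {1..})) \<and>
     (\<forall>I A. finite I \<longrightarrow> I \<subseteq> {1..} \<longrightarrow>
        (AE \<omega> in M.
           cond_prob_given M (sigma_generated M P) {\<omega>\<in>space M. \<forall>i\<in>I. X i \<omega> \<in> A i} \<omega> =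
           (\<Prod>i\<in>I. cond_prob_given M (sigma_generated M P) {\<omega>\<in>space M. X i \<omega> \<in> A i} \<omega>))) \<and>
     (\<forall>i\<ge>1. \<forall>j\<ge>1.
        AE \<omega> in M. cond_prob_given M (sigma_generated M P) {\<omega>\<in>space M. X i \<omega> = j} \<omega> = P j \<omega>)"

definition sample :: "(nat \<Rightarrow> 'a \<Rightarrow> nat) \<Rightarrow> nat \<Rightarrow> 'a \<Rightarrow> nat list" where
  "sample X n \<omega> = map (\<lambda>i. X i \<omega>) [1..<Suc n]"

definition distinct_values :: "nat list \<Rightarrow> nat list" where
  "distinct_values xs = sorted_list_of_set (set xs)"

definition value_ordered_freqs :: "nat list \<Rightarrow> nat list" where
  "value_ordered_freqs xs = map (count_list xs) (distinct_values xs)"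

definition h :: "real \<Rightarrow> nat list \<Rightarrow> real" where
  "h \<alpha> ms = (real (hd ms) - \<alpha>) / (\<Sum>m\<leftarrow>ms. real m - \<alpha>)"

definition p_new :: "(nat \<Rightarrow> nat \<Rightarrow> real) \<Rightarrow> nat \<Rightarrow> nat \<Rightarrow> real" where
  "p_new V k n = V (k + 1) (n + 1) / V k n"

(* Ranks j and positions i count from 1, list positions from 0. *)
definition new_value_of_rank ::
  "(nat \<Rightarrow> 'a \<Rightarrow> nat) \<Rightarrow> nat \<Rightarrow> nat \<Rightarrow> 'a \<Rightarrow> bool" where
  "new_value_of_rank X n j \<omega> \<longleftrightarrow>
     X (n + 1) \<omega> \<notin> set (sample X n \<omega>) \<and>
     X (n + 1) \<omega> = distinct_values (sample X (n + 1) \<omega>) ! (j - 1)"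

definition old_value_of_rank ::
  "(nat \<Rightarrow> 'a \<Rightarrow> nat) \<Rightarrow> nat \<Rightarrow> nat \<Rightarrow> 'a \<Rightarrow> bool" where
  "old_value_of_rank X n j \<omega> \<longleftrightarrow>
     X (n + 1) \<omega> = distinct_values (sample X n \<omega>) ! (j - 1)"

end

theory Submission
  imports Defs
begin

text \<open>
Why the rule holds. Write \<open>X\<^sub>1, \<dots>, X\<^sub>n\<close> for the sample. Its ties form a Gibbs partition of
\<open>{1..n}\<close>, and because \<open>P\<close> lists the frequencies in order of appearance, comparing the values of
two sampled clusters amounts to asking which of them is met first by an independent sequence
drawn from the same population. When that sequence hits one of the sampled clusters not met so
far, it hits a cluster of size \<open>m\<close> with probability proportional to \<open>m - \<alpha>\<close>, since this is the
prediction rule of a Gibbs partition; the hits of clusters already met do not change the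
relative weights of the others. Hence the order is a size-biased one with weights \<open>m - \<alpha>\<close>, and
for every assignment of the positions \<open>1, \<dots>, n\<close> to ordered clusters of sizes \<open>ns = (n\<^sub>1, \<dots>,
n\<^sub>k)\<close> the probability that the sample realises it is \<open>freqs_prob ns\<close>, that is, \<open>V k n\<close> times
\<open>\<Prod>i. (1 - \<alpha>)\<^bsub>n\<^sub>i - 1\<^esub>\<close> times \<open>\<Prod>i. h \<alpha> (n\<^sub>i, \<dots>, n\<^sub>k)\<close>. The number of such assignments is the same
in numerator and denominator of the conditional probability, so the latter is a quotient of two
values of \<open>freqs_prob\<close>; \<open>freqs_prob_insert\<close> and \<open>freqs_prob_increment\<close> evaluate the two
quotients.

The sample and the partition are tied together by the frequencies \<open>P\<close> alone, and their joint law
may be anything compatible with that. The role of the independent sequence is therefore given to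
\<open>R\<close> itself. A partition of \<open>{1..T}\<close> is coded by the restricted growth word \<open>l\<close> of its cluster
labels, and exchangeability gives \<open>E[1{R T is coded by l} * \<Prod>y\<leftarrow>ys. P y] = word_prob (l @ ys)\<close>
for labels \<open>ys\<close> occurring in \<open>l\<close> (\<open>expectation_coded_by_word_freq\<close>), where \<open>word_prob\<close> is the
EPPF as a function of words. So \<open>ys\<close> acts as a continuation of \<open>l\<close> that hits known clusters
only. Reading the sample as such a continuation, a purely finite recursion in \<open>T\<close>
(\<open>matching_step\<close>) shows that the weight of all ways to match the ordered clusters of the sample
with labels in increasing order, each partial matching being weighted by the probability
\<open>order_prob\<close> that the remaining clusters will appear in the prescribed order, does not depend on
\<open>T\<close>. At \<open>T = 0\<close> this weight is \<open>freqs_prob ns\<close>. As \<open>T\<close> tends to infinity the partial matchings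
vanish because the frequencies sum to one (\<open>new_cluster_prob_tendsto_0\<close>), and the complete
matchings tend to the probability of the order pattern (\<open>pattern_mean_freq_tendsto\<close>,
\<open>prob_pattern_sample\<close>).
\<close>

section \<open>The partition probability function evaluated on words\<close>

lemma count_list_pos: "a \<in> set u \<Longrightarrow> 1 \<le> count_list u a"
  by (metis count_list_0_iff less_one not_le)

locale gibbs =
  fixes \<alpha> :: real and V :: "nat \<Rightarrow> nat \<Rightarrow> real"
  assumes alpha_less_1: "\<alpha> < 1" and weights: "gibbs_weights \<alpha> V"
begin

text \<open>
The EPPF at the multiplicities of the letters of a word. Letters are of arbitrary type so that
labels of different origins can be mixed in one word, and the value depends on the word only up
to rearrangement and injective relabelling; both invariances together are exchangeability.
\<close>

definition word_prob :: "'b list \<Rightarrow> real" where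
  "word_prob u = V (card (set u)) (length u) *
     (\<Prod>a\<in>set u. pochhammer (1 - \<alpha>) (count_list u a - 1))"

lemma word_prob_mset:
  assumes "mset u = mset u'"
  shows "word_prob u = word_prob u'"
proof -
  have "set u = set u'" "length u = length u'"
    using assms by (auto dest: mset_eq_setD mset_eq_length)
  moreover have "count_list u = count_list u'"
    using assms by (metis count_mset ext)
  ultimately show ?thesis by (simp add: word_prob_def)
qed

lemma word_prob_map:
  assumes "inj_on f (set u)"
  shows "word_prob (map f u) = word_prob u"
proof -
  have "(\<Prod>a\<in>f ` set u. pochhammer (1 - \<alpha>) (count_list (map f u) a - 1)) =
        (\<Prod>a\<in>set u. pochhammer (1 - \<alpha>) (count_list u a - 1))"
    unfolding prod.reindex[OF assms] o_def
    by (intro prod.cong refl) (simp add: count_list_inj_map[OF assms])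
  then show ?thesis by (simp add: word_prob_def card_image[OF assms])
qed

lemma word_prob_snoc_old:
  assumes "a \<in> set u"
  shows "word_prob (u @ [a]) = (real (count_list u a) - \<alpha>) * V (card (set u)) (Suc (length u)) *
     (\<Prod>a\<in>set u. pochhammer (1 - \<alpha>) (count_list u a - 1))"
proof -
  have s: "set (u @ [a]) = set u" using assms by auto
  obtain m where m: "count_list u a = Suc m"
    using count_list_pos[OF assms] by (cases "count_list u a") auto
  have "pochhammer (1 - \<alpha>) (count_list u a) =
        pochhammer (1 - \<alpha>) (count_list u a - 1) * (real (count_list u a) - \<alpha>)"
    by (simp add: m pochhammer_Suc algebra_simps)
  moreover have "(\<Prod>b\<in>set u. pochhammer (1 - \<alpha>) (count_list (u @ [a]) b - 1)) =
     pochhammer (1 - \<alpha>) (count_list u a) *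
     (\<Prod>b\<in>set u - {a}. pochhammer (1 - \<alpha>) (count_list u b - 1))"
    by (subst prod.remove[OF _ assms]) (auto intro!: prod.cong split: if_splits)
  moreover have "(\<Prod>b\<in>set u. pochhammer (1 - \<alpha>) (count_list u b - 1)) =
     pochhammer (1 - \<alpha>) (count_list u a - 1) *
     (\<Prod>b\<in>set u - {a}. pochhammer (1 - \<alpha>) (count_list u b - 1))"
    by (subst prod.remove[OF _ assms]) auto
  ultimately show ?thesis
    unfolding word_prob_def s by (simp add: mult_ac)
qed

lemma word_prob_snoc_new:
  assumes "a \<notin> set u"
  shows "word_prob (u @ [a]) = V (Suc (card (set u))) (Suc (length u)) *
     (\<Prod>a\<in>set u. pochhammer (1 - \<alpha>) (count_list u a - 1))"
proof -
  have "(\<Prod>b\<in>insert a (set u). pochhammer (1 - \<alpha>) (count_list (u @ [a]) b - 1)) =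
     (\<Prod>b\<in>set u. pochhammer (1 - \<alpha>) (count_list u b - 1))"
    using assms by (auto simp: count_list_0_iff intro!: prod.cong)
  then show ?thesis
    using assms by (simp add: word_prob_def)
qed

lemma card_set_bounds: "u \<noteq> [] \<Longrightarrow> card (set u) \<in> {1..length u}"
  using card_length[of u] card_gt_0_iff[of "set u"] by simp

lemma V_pos: "1 \<le> k \<Longrightarrow> k \<le> n \<Longrightarrow> V k n > 0"
  using weights unfolding gibbs_weights_def by (metis atLeastAtMost_iff)

lemma V_rec: "1 \<le> k \<Longrightarrow> k \<le> n \<Longrightarrow> V k n = (real n - real k * \<alpha>) * V k (Suc n) + V (Suc k) (Suc n)"
  using weights unfolding gibbs_weights_def by (metis atLeastAtMost_iff Suc_eq_plus1)

lemma word_prob_pos: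
  assumes "u \<noteq> []"
  shows "0 < word_prob u"
  unfolding word_prob_def using card_set_bounds[OF assms] alpha_less_1
  by (intro mult_pos_pos V_pos prod_pos pochhammer_pos) auto

text \<open>
The prediction rule: by the recursion for \<open>V\<close>, the probabilities of repeating a letter and of
using a new one add up, where it does not matter which new letter stands for a new cluster.
\<close>

lemma word_prob_consistent:
  assumes "u \<noteq> []" "c \<notin> set u"
  shows "word_prob u = (\<Sum>a\<in>set u. word_prob (u @ [a])) + word_prob (u @ [c])"
proof -
  let ?\<Pi> = "\<Prod>a\<in>set u. pochhammer (1 - \<alpha>) (count_list u a - 1)"
  have "(\<Sum>a\<in>set u. word_prob (u @ [a])) =
        (\<Sum>a\<in>set u. (real (count_list u a) - \<alpha>)) * V (card (set u)) (Suc (length u)) * ?\<Pi>"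
    by (simp add: word_prob_snoc_old sum_distrib_right cong: sum.cong)
  also have "(\<Sum>a\<in>set u. (real (count_list u a) - \<alpha>)) = real (length u) - real (card (set u)) * \<alpha>"
    using sum_count_set[of u "set u"] by (simp add: sum_subtractf flip: of_nat_sum)
  finally have old: "(\<Sum>a\<in>set u. word_prob (u @ [a])) =
    (real (length u) - real (card (set u)) * \<alpha>) * V (card (set u)) (Suc (length u)) * ?\<Pi>" .
  have "word_prob u = V (card (set u)) (length u) * ?\<Pi>"
    by (simp add: word_prob_def)
  also have "V (card (set u)) (length u) =
     (real (length u) - real (card (set u)) * \<alpha>) * V (card (set u)) (Suc (length u)) +
     V (Suc (card (set u))) (Suc (length u))"
    using card_set_bounds[OF assms(1)] by (intro V_rec) auto
  finally show ?thesis
    unfolding old word_prob_snoc_new[OF assms(2)] by (simp only: distrib_right)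
qed

lemma word_prob_snoc_le:
  assumes "u \<noteq> []" "infinite (UNIV :: 'b set)"
  shows "word_prob (u @ [a :: 'b]) \<le> word_prob u"
proof -
  obtain c where c: "c \<notin> set u" using assms(2) ex_new_if_finite by blast
  show ?thesis
  proof (cases "a \<in> set u")
    case True
    have "word_prob (u @ [a]) \<le> (\<Sum>a\<in>set u. word_prob (u @ [a]))"
      by (rule member_le_sum[OF True]) (auto intro: less_imp_le[OF word_prob_pos])
    then show ?thesis
      using word_prob_consistent[OF assms(1) c] word_prob_pos[of "u @ [c]"] by simp
  next
    case False
    then show ?thesis
      using word_prob_consistent[OF assms(1) False]
      by (simp add: sum_nonneg less_imp_le[OF word_prob_pos])
  qed
qed

lemma word_prob_append_le:
  assumes "u \<noteq> []" "infinite (UNIV :: 'b set)"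
  shows "word_prob (u @ v) \<le> word_prob (u :: 'b list)"
proof (induction v rule: rev_induct)
  case (snoc a v)
  then show ?case using word_prob_snoc_le[of "u @ v" a] assms by simp
qed simp

text \<open>
Iterating the prediction rule; the bound is not an equality since continuations using new
letters are left out. It controls the weight of many continuations at once.
\<close>

lemma sum_word_prob_append_le:
  assumes "u \<noteq> []" "infinite (UNIV :: 'b set)"
  shows "(\<Sum>v | set v \<subseteq> set u \<and> length v = r. word_prob (u @ v)) \<le> word_prob (u :: 'b list)"
proof (induction r)
  case 0
  have "{v. set v \<subseteq> set u \<and> length v = 0} = {[]}" by auto
  then show ?case by simp
next
  case (Suc r)
  obtain c where c: "c \<notin> set u" using assms(2) ex_new_if_finite by blast
  let ?A = "\<lambda>r. {v. set v \<subseteq> set u \<and> length v = r}"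
  have A: "?A (Suc r) = (\<lambda>(v, a). v @ [a]) ` (?A r \<times> set u)"
  proof safe
    fix v assume "set v \<subseteq> set u" "length v = Suc r"
    then have "v = butlast v @ [last v]" "set (butlast v) \<subseteq> set u" "last v \<in> set u"
      using in_set_butlastD[of _ v] last_in_set[of v] append_butlast_last_id[of v]
      by (cases v; force)+
    then show "v \<in> (\<lambda>(v, a). v @ [a]) ` (?A r \<times> set u)"
      using \<open>length v = Suc r\<close> by (intro image_eqI[of _ _ "(butlast v, last v)"]) auto
  qed auto
  have "(\<Sum>v\<in>?A (Suc r). word_prob (u @ v)) = (\<Sum>v\<in>?A r. \<Sum>a\<in>set u. word_prob (u @ v @ [a]))"
    unfolding A by (subst sum.reindex) (auto simp: inj_on_def sum.cartesian_product
      case_prod_unfold)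
  also have "\<dots> \<le> (\<Sum>v\<in>?A r. word_prob (u @ v))"
  proof (rule sum_mono)
    fix v assume v: "v \<in> ?A r"
    then have s: "set (u @ v) = set u" by auto
    show "(\<Sum>a\<in>set u. word_prob (u @ v @ [a])) \<le> word_prob (u @ v)"
      using word_prob_consistent[of "u @ v" c] word_prob_pos[of "u @ v @ [c]"] assms(1) c
      unfolding s by simp
  qed
  also note Suc
  finally show ?case .
qed

end

section \<open>Restricted growth words and set partitions\<close>

text \<open>
Restricted growth words of length \<open>T\<close>: a new letter is always the smallest unused positive
number. They code the partitions of \<open>{1..T}\<close> with clusters labelled in order of appearance.
\<close>

fun rgs :: "nat \<Rightarrow> nat list set" where
  "rgs 0 = {[]}"
| "rgs (Suc T) = (\<lambda>(l, a). l @ [a]) ` (SIGMA l:rgs T. {1..Suc (card (set l))})"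

lemma length_rgs: "l \<in> rgs T \<Longrightarrow> length l = T"
  by (induction T arbitrary: l) auto

lemma finite_rgs: "finite (rgs T)"
  by (induction T) auto

lemma snoc_rgs_iff: "l @ [a] \<in> rgs (Suc T) \<longleftrightarrow> l \<in> rgs T \<and> a \<in> {1..Suc (card (set l))}"
  by auto

lemma set_rgs: "l \<in> rgs T \<Longrightarrow> set l = {1..card (set l)}"
proof (induction T arbitrary: l)
  case (Suc T)
  then obtain l' a where l: "l = l' @ [a]" "l' \<in> rgs T" "a \<in> {1..Suc (card (set l'))}" by auto
  let ?K = "card (set l')"
  have s: "set l' = {1..?K}" using Suc.IH l(2) .
  show ?case
  proof (cases "a \<in> set l'")
    case True
    then have "set l = set l'" using l(1) by auto
    then show ?thesis using s by simp
  next
    case False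
    then have "a = Suc ?K" using l(3) s by (metis atLeastAtMost_iff le_Suc_eq)
    moreover have "card (set l) = Suc ?K" using False l(1) by simp
    ultimately show ?thesis using l(1) s by (auto simp: atLeastAtMostSuc_conv)
  qed
qed simp

definition block :: "nat list \<Rightarrow> nat \<Rightarrow> nat set" where
  "block l a = {t \<in> {1..length l}. l ! (t - 1) = a}"

definition word_partition :: "nat list \<Rightarrow> nat set set" where
  "word_partition l = block l ` set l"

lemma block_Nil [simp]: "block [] a = {}"
  by (simp add: block_def)

lemma block_snoc:
  "block (l @ [a]) b = (if b = a then insert (Suc (length l)) (block l b) else block l b)"
proof (intro set_eqI)
  fix t
  show "t \<in> block (l @ [a]) b \<longleftrightarrow> t \<in> (if b =
    a then insert (Suc (length l)) (block l b) else block l b)"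
    by (cases "t \<le> length l"; cases "t = Suc (length l)") (auto simp: block_def nth_append)
qed

lemma block_subset: "block l a \<subseteq> {1..length l}"
  by (auto simp: block_def)

lemma finite_block [simp]: "finite (block l a)"
  by (rule finite_subset[OF block_subset]) simp

lemma Suc_length_notin_block [simp]: "Suc (length l) \<notin> block l a"
  using block_subset[of l a] by auto

lemma card_block: "card (block l a) = count_list l a"
  by (induction l rule: rev_induct) (auto simp: block_snoc)

lemma block_eq_empty_iff [simp]: "block l a = {} \<longleftrightarrow> a \<notin> set l"
  by (metis card_block card_0_eq count_list_0_iff finite_block)

lemma block_disjoint: "a \<noteq> b \<Longrightarrow> block l a \<inter> block l b = {}"
  by (auto simp: block_def)

lemma inj_on_block: "inj_on (block l) (set l)"
  using block_disjoint block_eq_empty_iff by (metis inf.idem inj_onI)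

lemma partition_on_word_partition: "partition_on {1..length l} (word_partition l)"
proof (rule partition_onI)
  show "\<Union> (word_partition l) = {1..length l}"
    by (auto simp: word_partition_def block_def)
  show "disjnt p p'" if "p \<in> word_partition l" "p' \<in> word_partition l" "p \<noteq> p'" for p p'
    using that by (auto simp: word_partition_def block_def disjnt_def)
  show "{} \<notin> word_partition l"
    by (metis block_eq_empty_iff imageE word_partition_def)
qed

lemma Min_block_le:
  assumes "b \<in> set l"
  shows "Min (block l b) \<le> length l"
proof -
  have "Min (block l b) \<in> block l b" using assms by (intro Min_in) auto
  then show ?thesis using block_subset[of l b] by auto
qed

lemma Min_block_snoc:
  assumes "b \<in> set l"
  shows "Min (block (l @ [a]) b) = Min (block l b)"
proof (cases "a = b")
  case True
  have "Min (insert (Suc (length l)) (block l b)) = min (Suc (length l)) (Min (block l b))"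
    using assms by (intro Min_insert) auto
  also have "Min (block l b) \<le> Suc (length l)"
    using Min_block_le[OF assms] by simp
  then have "min (Suc (length l)) (Min (block l b)) = Min (block l b)" by simp
  finally show ?thesis using True by (simp add: block_snoc)
qed (simp add: block_snoc)

text \<open>
The labels of a restricted growth word follow the order of least elements, which makes label \<open>j\<close>
the \<open>j\<close>th cluster in order of appearance.
\<close>

lemma Min_block_less:
  assumes "l \<in> rgs T" "a \<in> set l" "b \<in> set l" "a < b"
  shows "Min (block l a) < Min (block l b)"
  using assms
proof (induction T arbitrary: l)
  case (Suc T)
  obtain l' c where l: "l = l' @ [c]" "l' \<in> rgs T" "c \<in> {1..Suc (card (set l'))}"
    using Suc.prems(1) by auto
  have s: "set l' = {1..card (set l')}" by (rule set_rgs[OF l(2)])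
  have a: "a \<in> set l'"
  proof (rule ccontr)
    assume "a \<notin> set l'"
    with Suc.prems l have "a = c" "b \<in> set l'" by auto
    moreover have "c = Suc (card (set l'))"
      using \<open>a \<notin> set l'\<close> \<open>a = c\<close> l(3) s by (metis atLeastAtMost_iff le_Suc_eq)
    moreover have "b \<le> card (set l')"
      using \<open>b \<in> set l'\<close> s by (metis atLeastAtMost_iff)
    ultimately show False using Suc.prems(4) by simp
  qed
  show ?case
  proof (cases "b \<in> set l'")
    case True
    then show ?thesis
      using Suc.IH[OF l(2) a True Suc.prems(4)] a by (simp add: l(1) Min_block_snoc)
  next
    case False
    then have "block l' b = {}" by simp
    then have "b = c" "block l b = {Suc (length l')}"
      using False Suc.prems(3) l(1) by (auto simp only: block_snoc) auto
    moreover have "Min (block l' a) \<le> length l'"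
      using a by (rule Min_block_le)
    ultimately show ?thesis using a by (simp add: l(1) Min_block_snoc)
  qed
qed simp

lemma (in linorder) sorted_key_list_of_set_eqI:
  assumes "inj_on f A" "finite A" "sorted_wrt (<) (map f xs)" "set xs = A" "length xs = card A"
  shows "sorted_key_list_of_set f A = xs"
proof -
  interpret folding_insort_key "(\<le>)" "(<)" A f
    by unfold_locales (rule assms(1))
  show ?thesis
    using sorted_key_list_of_set_unique[OF subset_refl assms(2), of xs] assms(3-5) by blast
qed

lemma cluster_size_word_partition:
  assumes "l \<in> rgs T" "1 \<le> j"
  shows "cluster_size j (word_partition l) = count_list l j"
proof -
  let ?K = "card (set l)"
  let ?Cs = "map (block l) [1..<Suc ?K]"
  have s: "set l = set [1..<Suc ?K]"
    using set_rgs[OF assms(1)] by (metis atLeastLessThanSuc_atLeastAtMost set_upt)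
  have less: "Min (block l a) < Min (block l b)" if "a \<in> set l" "b \<in> set l" "a < b" for a b
    using Min_block_less[OF assms(1) that] .
  have inj: "inj_on Min (word_partition l)"
  proof (rule inj_onI)
    fix B C assume "B \<in> word_partition l" "C \<in> word_partition l" and eq: "Min B = Min C"
    then obtain a b where ab: "a \<in> set l" "b \<in> set l" "B = block l a" "C = block l b"
      by (auto simp: word_partition_def)
    then show "B = C"
      using less eq by (metis linorder_neq_iff order_less_irrefl)
  qed
  have set_Cs: "set ?Cs = word_partition l"
    by (simp only: set_map word_partition_def s[symmetric])
  have "sorted_wrt (\<lambda>a b. Min (block l a) < Min (block l b)) [1..<Suc ?K]"
  proof (rule sorted_wrt_mono_rel[of _ "(<)"])
    fix a b assume "a \<in> set [1..<Suc ?K]" "b \<in> set [1..<Suc ?K]" "a < b"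
    then show "Min (block l a) < Min (block l b)" using less s by blast
  qed (rule sorted_wrt_upt)
  then have srt: "sorted_wrt (<) (map Min ?Cs)"
    by (simp only: sorted_wrt_map)
  have len: "length ?Cs = card (word_partition l)"
    unfolding word_partition_def card_image[OF inj_on_block] by (simp del: upt_Suc)
  have "sorted_key_list_of_set Min (word_partition l) = ?Cs"
    by (rule sorted_key_list_of_set_eqI[OF inj _ srt set_Cs len]) (simp add: word_partition_def)
  then have "cluster_size j (word_partition l) =
    (if j \<le> ?K then card (?Cs ! (j - 1)) else 0)"
    using assms(2) by (simp add: cluster_size_def Let_def del: upt_Suc)
  also have "\<dots> = count_list l j"
  proof (cases "j \<le> ?K")
    case True
    then have "?Cs ! (j - 1) = block l j"
      using assms(2) by (subst nth_map) (auto simp del: upt_Suc)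
    then show ?thesis using True by (simp add: card_block)
  next
    case False
    then have "j \<notin> set l" using set_rgs[OF assms(1)] by (metis atLeastAtMost_iff)
    then show ?thesis using False by simp
  qed
  finally show ?thesis .
qed

lemma restrict_partition_word_partition:
  "restrict_partition (length l) (word_partition (l @ [a])) = word_partition l"
proof -
  have "block (l @ [a]) b \<inter> {1..length l} = block l b" for b
    using block_subset[of l b] by (auto simp: block_snoc)
  then have "restrict_partition (length l) (word_partition (l @ [a])) =
    block l ` set (l @ [a]) - {{}}"
    by (simp add: restrict_partition_def word_partition_def image_image)
  also have "\<dots> = word_partition l"
    by (cases "a \<in> set l") (auto simp: word_partition_def)
  finally show ?thesis .
qed

lemma word_partition_snoc_inj:
  assumes "l \<in> rgs T" "a \<in> {1..Suc (card (set l))}" "b \<in> {1..Suc (card (set l))}"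
    and "word_partition (l @ [a]) = word_partition (l @ [b])"
  shows "a = b"
proof -
  have "block (l @ [a]) a \<in> word_partition (l @ [b])"
    using assms(4) by (metis in_set_conv_decomp imageI word_partition_def)
  then obtain c where c: "block (l @ [a]) a = block (l @ [b]) c"
    by (auto simp: word_partition_def)
  moreover have "Suc (length l) \<in> block (l @ [a]) a" by (simp add: block_snoc)
  ultimately have "c = b" by (auto simp: block_snoc split: if_splits)
  with c have "insert (Suc (length l)) (block l a) = insert (Suc (length l)) (block l b)"
    by (simp add: block_snoc)
  then have eq: "block l a = block l b"
    by (metis Suc_length_notin_block insert_ident)
  show ?thesis
  proof (cases "a \<in> set l")
    case True
    then show ?thesis using eq block_disjoint by (metis block_eq_empty_iff inf.idem)
  next
    case False
    then have "b \<notin> set l" using eq by (metis block_eq_empty_iff)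
    then show ?thesis
      using False assms(2,3) set_rgs[OF assms(1)] by (metis atLeastAtMost_iff le_Suc_eq)
  qed
qed

lemma image_restrict_id:
  "(\<And>C. C \<in> \<A> \<Longrightarrow> C \<inter> D = C \<and> C \<noteq> {}) \<Longrightarrow> (\<lambda>C. C \<inter> D) ` \<A> = \<A>"
  by (force simp: image_iff)

text \<open>
Every partition of \<open>{1..T+1}\<close> arises from its restriction by putting \<open>T+1\<close> into an existing
block or into a block of its own, which on codes is appending an admissible letter.
\<close>

lemma word_partition_extend:
  assumes l: "l \<in> rgs T" and part: "partition_on {1..Suc T} \<pi>"
    and restr: "restrict_partition T \<pi> = word_partition l"
  shows "\<exists>a\<in>{1..Suc (card (set l))}. \<pi> = word_partition (l @ [a])"
proof -
  have len: "length l = T" by (rule length_rgs[OF l])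
  have "Suc T \<in> \<Union>\<pi>" using part by (simp add: partition_on_def)
  then obtain B where B: "B \<in> \<pi>" "Suc T \<in> B" by blast
  have other: "C \<inter> {1..T} = C \<and> C \<noteq> {}" if "C \<in> \<pi> - {B}" for C
  proof -
    have "Suc T \<notin> C" using that B part by (auto simp: partition_on_def disjoint_def)
    moreover have "C \<subseteq> {1..Suc T}" "C \<noteq> {}" using that part by (auto simp: partition_on_def)
    ultimately show ?thesis by (auto simp: le_Suc_eq)
  qed
  have "B \<subseteq> {1..Suc T}" using B part by (auto simp: partition_on_def)
  then have BT: "B \<inter> {1..T} = B - {Suc T}" by (auto simp: le_Suc_eq)
  have ins: "\<pi> = insert B (\<pi> - {B})" using B by auto
  have "(\<lambda>C. C \<inter> {1..T}) ` \<pi> = insert (B - {Suc T}) ((\<lambda>C. C \<inter> {1..T}) ` (\<pi> - {B}))"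
    by (subst ins) (simp only: image_insert BT)
  also have "(\<lambda>C. C \<inter> {1..T}) ` (\<pi> - {B}) = \<pi> - {B}"
    using other by (rule image_restrict_id)
  finally have wp: "word_partition l = insert (B - {Suc T}) (\<pi> - {B}) - {{}}"
    using restr by (simp add: restrict_partition_def)
  have ne: "{} \<notin> \<pi> - {B}" using other by blast
  show ?thesis
  proof (cases "B = {Suc T}")
    case True
    then have "word_partition l = \<pi> - {B}" using wp ne by auto
    moreover have new: "Suc (card (set l)) \<notin> set l" using set_rgs[OF l]
      by (metis atLeastAtMost_iff not_less_eq_eq order_refl)
    have "word_partition (l @ [Suc (card (set l))]) = insert {Suc T} (word_partition l)"
    proof -
      let ?c = "Suc (card (set l))"
      have "block l ?c = {}" using new by simp
      then have "block (l @ [?c]) ?c = {Suc T}" by (simp only: block_snoc len) simp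
      moreover have "block (l @ [?c]) ` set l = block l ` set l"
        using new by (intro image_cong) (auto simp: block_snoc)
      ultimately show ?thesis by (simp add: word_partition_def)
    qed
    ultimately have "\<pi> = word_partition (l @ [Suc (card (set l))])" using ins True by simp
    then show ?thesis by (intro bexI[of _ "Suc (card (set l))"]) auto
  next
    case False
    then have nonempty: "B - {Suc T} \<noteq> {}" using B by auto
    then have wp': "word_partition l = insert (B - {Suc T}) (\<pi> - {B})" using wp ne by auto
    then obtain a where a: "a \<in> set l" "B - {Suc T} = block l a"
      by (metis imageE insertI1 word_partition_def)
    have "B - {Suc T} \<notin> \<pi> - {B}"
    proof
      assume *: "B - {Suc T} \<in> \<pi> - {B}"
      then have "(B - {Suc T}) \<inter> B = {}"
        using part B by (auto simp: partition_on_def disjoint_def)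
      then show False using nonempty by auto
    qed
    then have "\<pi> - {B} = word_partition l - {block l a}" using wp' a(2) by auto
    also have "\<dots> = block l ` (set l - {a})"
      unfolding word_partition_def using a(1) inj_on_block
        by (subst inj_on_image_set_diff[of _ "set l"]) auto
    finally have "\<pi> = insert (insert (Suc T) (block l a)) (block l ` (set l - {a}))"
      using ins a(2) B by (metis insert_Diff)
    also have "\<dots> = word_partition (l @ [a])"
    proof -
      have "set (l @ [a]) = insert a (set l - {a})" using a(1) by auto
      then have "word_partition (l @ [a]) =
        insert (block (l @ [a]) a) (block (l @ [a]) ` (set l - {a}))"
        by (simp only: word_partition_def image_insert)
      also have "block (l @ [a]) ` (set l - {a}) = block l ` (set l - {a})"
        by (intro image_cong) (auto simp: block_snoc)
      finally show ?thesis by (simp add: block_snoc len)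
    qed
    finally have "\<pi> = word_partition (l @ [a])" .
    moreover have "a \<in> {1..Suc (card (set l))}"
      using a(1) set_rgs[OF l] by (metis atLeastAtMost_iff le_SucI)
    ultimately show ?thesis by blast
  qed
qed

section \<open>Ordering the clusters of a sample by an independent exploration\<close>

lemma infinite_UNIV_sum_nat: "infinite (UNIV :: (nat + nat) set)"
  by (simp flip: UNIV_Plus_UNIV)

text \<open>
A strictly increasing list containing an upper bound of its entries ends with it. A new label is
larger than all earlier ones, so a list of matched labels can only grow at its end.
\<close>

lemma sorted_wrt_less_append_max:
  assumes "sorted_wrt (<) (j :: nat list)" "c \<in> set j" "\<And>b. b \<in> set j \<Longrightarrow> b \<le> c"
  shows "\<exists>j'. j = j' @ [c]"
proof -
  have ne: "j \<noteq> []" using assms(2) by auto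
  have j: "j = butlast j @ [last j]" using ne by simp
  have "last j = c"
  proof (rule ccontr)
    assume "last j \<noteq> c"
    then have "c \<in> set (butlast j)" using assms(2) by (subst (asm) j) auto
    then have "c < last j" using assms(1) by (subst (asm) j) (auto simp: sorted_wrt_append)
    then show False using assms(3)[of "last j"] ne by simp
  qed
  then show ?thesis using j by metis
qed

context gibbs begin

text \<open>
The ordered clusters of a sample are numbered \<open>0, 1, \<dots>\<close>. Those matched with the labels \<open>j\<close> of
the explored word get these labels as letters \<open>Inl\<close>; the others keep their number as a letter
\<open>Inr\<close>, which keeps them apart from all labels present and future.
\<close>

definition letter :: "nat list \<Rightarrow> nat \<Rightarrow> nat + nat" where
  "letter j i = (if i < length j then Inl (j ! i) else Inr i)"

definition joint_word :: "nat list \<Rightarrow> nat list \<Rightarrow> nat list \<Rightarrow> (nat + nat) list" where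
  "joint_word w l j = map Inl l @ map (letter j) w"

text \<open>
The states of the exploration after \<open>T\<close> steps: the explored word \<open>l\<close> together with the labels
\<open>j\<close> of the first \<open>length j\<close> of the \<open>k\<close> sample clusters. Increasing \<open>j\<close> means that these clusters
appeared in the prescribed order.
\<close>

definition matchings :: "nat \<Rightarrow> nat \<Rightarrow> (nat list \<times> nat list) set" where
  "matchings k T = {(l, j). l \<in> rgs T \<and> sorted_wrt (<) j \<and> set j \<subseteq> set l \<and> length j \<le> k}"

lemma finite_matchings: "finite (matchings k T)"
proof (rule finite_subset)
  show "matchings k T \<subseteq> (SIGMA l:rgs T. {j. set j \<subseteq> set l \<and> length j \<le> k})"
    by (auto simp: matchings_def)
qed (auto simp: finite_rgs intro: finite_lists_length_le)

lemma matchings_0: "matchings k 0 = {([], [])}"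
  by (auto simp: matchings_def)

text \<open>
One step of the exploration. The new letter either leaves the matching as it is, or opens a
cluster that is matched with the next sample cluster; the latter happens exactly when the last
matched label is the new one, so every state has a unique predecessor.
\<close>

lemma sum_matchings_Suc:
  "(\<Sum>(l, j)\<in>matchings k (Suc T). f l j) =
   (\<Sum>(l, j)\<in>matchings k T. (\<Sum>a\<in>{1..Suc (card (set l))}. f (l @ [a]) j) +
      (if length j < k then f (l @ [Suc (card (set l))]) (j @ [Suc (card (set l))]) else 0))"
proof -
  let ?K = "\<lambda>l. Suc (card (set l))"
  define A where "A = (\<lambda>((l, j), a). (l @ [a], j)) ` (SIGMA (l, j):matchings k T. {1..?K l})"
  define B where "B = (\<lambda>(l, j). (l @ [?K l], j @ [?K l])) ` {(l, j) \<in> matchings k T. length j < k}"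
  have fin: "finite A" "finite B"
    unfolding A_def B_def
    by (auto intro!: finite_imageI finite_SigmaI finite_matchings intro: finite_subset[OF _
      finite_matchings])
  have new: "?K l \<notin> set l" if "l \<in> rgs T" for l
    using set_rgs[OF that] by (metis atLeastAtMost_iff not_less_eq_eq order_refl)
  have disj: "A \<inter> B = {}"
    using new by (auto simp: A_def B_def matchings_def)
  have union: "matchings k (Suc T) = A \<union> B"
  proof (intro set_eqI iffI)
    fix s assume s: "s \<in> matchings k (Suc T)"
    obtain l' j where s_eq: "s = (l', j)" by (cases s)
    with s have l': "l' \<in> rgs (Suc T)" and j: "sorted_wrt (<) j" "set j \<subseteq> set l'" "length j \<le> k"
      by (auto simp: matchings_def)
    from l' obtain l a where l: "l' = l @ [a]" "l \<in> rgs T" "a \<in> {1..?K l}" by auto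
    show "s \<in> A \<union> B"
    proof (cases "set j \<subseteq> set l")
      case True
      then have "((l, j), a) \<in> (SIGMA (l, j):matchings k T. {1..?K l})"
        using l j by (auto simp: matchings_def)
      then have "s \<in> A" unfolding A_def s_eq l(1) by (rule rev_image_eqI) simp
      then show ?thesis by simp
    next
      case False
      then have a: "a \<in> set j" "a \<notin> set l" using j(2) l(1) by auto
      then have aK: "a = ?K l" using l(3) set_rgs[OF l(2)] by (metis atLeastAtMost_iff le_Suc_eq)
      have "b \<le> a" if "b \<in> set j" for b
      proof -
        have "b \<in> insert a (set l)" using that j(2) l(1) by auto
        then show ?thesis using set_rgs[OF l(2)] aK
          by (metis atLeastAtMost_iff insertE le_SucI order_refl)
      qed
      then obtain j' where j': "j = j' @ [a]"
        using sorted_wrt_less_append_max[OF j(1) a(1)] by blast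
      have "(l, j') \<in> {(l, j) \<in> matchings k T. length j < k}"
        using j l j' by (auto simp: matchings_def sorted_wrt_append)
      then have "s \<in> B" unfolding B_def s_eq l(1) j' aK by (rule rev_image_eqI) simp
      then show ?thesis by simp
    qed
  next
    fix s assume "s \<in> A \<union> B"
    then consider l j a where "s = (l @ [a], j)" "(l, j) \<in> matchings k T" "a \<in> {1..?K l}"
      | l j where "s = (l @ [?K l], j @ [?K l])" "(l, j) \<in> matchings k T" "length j < k"
      unfolding A_def B_def by auto
    then show "s \<in> matchings k (Suc T)"
    proof cases
      case 1
      then show ?thesis using snoc_rgs_iff[of l a T]
        by (auto simp: matchings_def simp del: rgs.simps)
    next
      case 2
      then have l: "l \<in> rgs T" "sorted_wrt (<) j" "set j \<subseteq> set l" by (auto simp: matchings_def)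
      have "b < ?K l" if "b \<in> set j" for b
      proof -
        have "b \<in> set l" using that l(3) by auto
        then show ?thesis using set_rgs[OF l(1)] by (metis atLeastAtMost_iff less_Suc_eq_le)
      qed
      then show ?thesis using 2 l snoc_rgs_iff[of l "?K l" T]
        by (auto simp: matchings_def sorted_wrt_append simp del: rgs.simps)
    qed
  qed
  have "(\<Sum>(l, j)\<in>A. f l j) = (\<Sum>((l, j), a)\<in>(SIGMA (l, j):matchings k T. {1..?K l}). f (l @ [a]) j)"
    unfolding A_def by (subst sum.reindex) (auto simp: inj_on_def case_prod_unfold)
  also have "\<dots> = (\<Sum>(l, j)\<in>matchings k T. \<Sum>a\<in>{1..?K l}. f (l @ [a]) j)"
    using sum.Sigma[of "matchings k T" "\<lambda>s. {1..?K (fst s)}" "\<lambda>s a. f (fst s @ [a]) (snd s)"]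
    by (simp add: finite_matchings case_prod_unfold del: sum.cl_ivl_Suc)
  finally have sA: "(\<Sum>(l, j)\<in>A. f l j) = (\<Sum>(l, j)\<in>matchings k T. \<Sum>a\<in>{1..?K l}. f (l @ [a]) j)" .
  have "(\<Sum>(l, j)\<in>B. f l j) =
     (\<Sum>(l, j)\<in>{(l, j) \<in> matchings k T. length j < k}. f (l @ [?K l]) (j @ [?K l]))"
    unfolding B_def by (subst sum.reindex) (auto simp: inj_on_def case_prod_unfold)
  also have "\<dots> = (\<Sum>(l, j)\<in>matchings k T. if length j < k then f (l @ [?K l]) (j @ [?K l]) else 0)"
    using sum.inter_filter[OF finite_matchings, of "\<lambda>s. f (fst s @ [?K (fst s)]) (snd s @ [?K (fst
      s)])" k T "\<lambda>s. length (snd s) < k"]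
    by (simp add: case_prod_unfold)
  finally have sB: "(\<Sum>(l, j)\<in>B. f l j) =
     (\<Sum>(l, j)\<in>matchings k T. if length j < k then f (l @ [?K l]) (j @ [?K l]) else 0)" .
  show ?thesis
    unfolding union sum.union_disjoint[OF fin disj] sA sB
    by (simp add: sum.distrib[symmetric] case_prod_unfold)
qed


text \<open>
The probability that the clusters numbered \<open>s, s + 1, \<dots>\<close> appear in this order, if at each stage
the next one is drawn with weights \<open>m - \<alpha>\<close> among those remaining.
\<close>

definition order_prob :: "nat list \<Rightarrow> nat \<Rightarrow> real" where
  "order_prob ns s = (\<Prod>i\<in>{s..<length ns}. h \<alpha> (drop i ns))"

lemma sum_list_h_denominator:
  "(\<Sum>m\<leftarrow>drop s ns. real m - \<alpha>) = (\<Sum>i\<in>{s..<length ns}. real (ns ! i) - \<alpha>)"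
proof -
  have "(\<Sum>m\<leftarrow>drop s ns. real m - \<alpha>) = (\<Sum>i<length ns - s. real (ns ! (s + i)) - \<alpha>)"
    by (simp add: sum_list_sum_nth atLeast0LessThan)
  also have "\<dots> = (\<Sum>i\<in>{s..<length ns}. real (ns ! i) - \<alpha>)"
    by (rule sum.reindex_bij_witness[of _ "\<lambda>i. i - s" "\<lambda>i. s + i"]) auto
  finally show ?thesis .
qed

lemma h_bounds:
  assumes "\<forall>m\<in>set ms. 1 \<le> m" "ms \<noteq> []"
  shows "0 < h \<alpha> ms" "h \<alpha> ms \<le> 1" "0 < (\<Sum>m\<leftarrow>ms. real m - \<alpha>)"
proof -
  obtain m ms' where ms: "ms = m # ms'" using assms(2) by (cases ms) auto
  have pos: "0 < real m - \<alpha>" using assms(1) alpha_less_1 ms by force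
  have "0 \<le> (\<Sum>m\<leftarrow>ms'. real m - \<alpha>)"
    using assms(1) alpha_less_1 ms by (intro sum_list_nonneg) force
  with pos show "0 < h \<alpha> ms" "h \<alpha> ms \<le> 1" "0 < (\<Sum>m\<leftarrow>ms. real m - \<alpha>)"
    by (auto simp: h_def ms intro!: divide_pos_pos)
qed

lemma order_prob_bounds:
  assumes "\<forall>m\<in>set ns. 1 \<le> m"
  shows "0 < order_prob ns s" "order_prob ns s \<le> 1"
proof -
  have "0 < h \<alpha> (drop i ns) \<and> h \<alpha> (drop i ns) \<le> 1" if "i \<in> {s..<length ns}" for i
    using h_bounds[of "drop i ns"] that assms by (auto dest: in_set_dropD)
  then show "0 < order_prob ns s" "order_prob ns s \<le> 1"
    unfolding order_prob_def by (auto intro!: prod_pos prod_le_1 intro: less_imp_le)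
qed

text \<open>
Among the unmatched clusters the next to appear is cluster \<open>s\<close> with a probability proportional
to its weight. This is the identity that makes \<open>order_prob\<close> harmonic along the exploration.
\<close>

lemma order_prob_Suc:
  assumes "\<forall>m\<in>set ns. 1 \<le> m" "s < length ns"
  shows "order_prob ns s * (\<Sum>i\<in>{s..<length ns}. real (ns ! i) - \<alpha>) =
         (real (ns ! s) - \<alpha>) * order_prob ns (Suc s)"
proof -
  have "order_prob ns s = h \<alpha> (drop s ns) * order_prob ns (Suc s)"
    unfolding order_prob_def using assms(2) by (simp add: prod.atLeast_Suc_lessThan)
  moreover have "0 < (\<Sum>i\<in>{s..<length ns}. real (ns ! i) - \<alpha>)"
    using h_bounds(3)[of "drop s ns"] assms
    unfolding sum_list_h_denominator by (auto dest: in_set_dropD)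
  ultimately show ?thesis
    using assms(2) unfolding h_def sum_list_h_denominator by (simp add: hd_drop_conv_nth)
qed

end

text \<open>
A word \<open>w\<close> over \<open>{0..<k}\<close> prescribes which positions of the sample carry the smallest value, the
second smallest value, and so on.
\<close>

locale gibbs_pattern = gibbs +
  fixes w :: "nat list" and k :: nat and ns :: "nat list"
  assumes set_w: "set w = {0..<k}" and k_pos: "0 < k"
    and ns_def: "ns = map (count_list w) [0..<k]"
begin

lemma length_ns: "length ns = k"
  by (simp add: ns_def)

lemma nth_ns: "i < k \<Longrightarrow> ns ! i = count_list w i"
  by (simp add: ns_def)

lemma ns_ge_1: "\<forall>m\<in>set ns. 1 \<le> m"
  using set_w by (auto simp: ns_def Suc_le_eq count_list_0_iff simp flip: neq0_conv)

lemma set_joint_word: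
  assumes "(l, j) \<in> matchings k T"
  shows "set (joint_word w l j) = Inl ` set l \<union> Inr ` {length j..<k}"
proof -
  have "letter j ` set w = Inl ` set j \<union> Inr ` {length j..<k}"
  proof -
    have "set w = {0..<length j} \<union> {length j..<k}"
      using assms set_w by (auto simp: matchings_def)
    moreover have "letter j ` {0..<length j} = Inl ` ((!) j ` {0..<length j})"
      by (auto simp: letter_def image_iff)
    moreover have "(!) j ` {0..<length j} = set j"
      by (auto simp: set_conv_nth image_iff)
    moreover have "letter j ` {length j..<k} = Inr ` {length j..<k}"
      by (auto simp: letter_def image_iff)
    ultimately show ?thesis by (simp add: image_Un)
  qed
  then show ?thesis
    using assms by (auto simp: joint_word_def matchings_def)
qed

lemma joint_word_nonempty: "joint_word w l j \<noteq> []"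
  using set_w k_pos by (auto simp: joint_word_def)

lemma count_letter_Inr:
  assumes "length j \<le> i"
  shows "count_list (map (letter j) w) (Inr i) = count_list w i"
  using assms by (induction w) (auto simp: letter_def)

lemma count_joint_word_Inr:
  assumes "i \<in> {length j..<k}"
  shows "count_list (joint_word w l j) (Inr i) = ns ! i"
proof -
  have "count_list (map Inl l) (Inr i :: nat + nat) = 0" by (subst count_list_0_iff) auto
  then show ?thesis using assms by (simp add: joint_word_def count_letter_Inr nth_ns)
qed

lemma word_prob_joint_word_snoc:
  "word_prob (joint_word w (l @ [a]) j) = word_prob (joint_word w l j @ [Inl a])"
  by (rule word_prob_mset) (simp add: joint_word_def)

text \<open>
Matching cluster \<open>length j\<close> with the new label \<open>c\<close> is the same as repeating the letter of this
so far unmatched cluster, up to renaming that letter into \<open>c\<close>.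
\<close>

lemma word_prob_joint_word_match:
  assumes "(l, j) \<in> matchings k T" "c \<notin> set l" "length j < k"
  shows "word_prob (joint_word w (l @ [c]) (j @ [c])) =
    word_prob (joint_word w l j @ [Inr (length j)])"
proof -
  \<comment> \<open>\<open>f\<close> renames the letter of the cluster being matched.\<close>
  define f where "f x = (if x = Inr (length j) then Inl c else x)" for x :: "nat + nat"
  have "letter (j @ [c]) i = f (letter j i)" for i
    by (auto simp: letter_def f_def nth_append less_Suc_eq)
  then have m: "map (letter (j @ [c])) w = map f (map (letter j) w)" by simp
  have "map Inl (l @ [c]) = map f (map Inl l @ [Inr (length j)])" by (simp add: f_def)
  then have jw: "joint_word w (l @ [c]) (j @ [c]) =
    map f (map Inl l @ [Inr (length j)] @ map (letter j) w)"
    unfolding joint_word_def m by simp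
  have "mset (joint_word w (l @ [c]) (j @ [c])) =
    mset (map f (joint_word w l j @ [Inr (length j)]))"
    by (simp only: jw mset_map) (simp add: joint_word_def)
  then have "word_prob (joint_word w (l @ [c]) (j @ [c])) =
     word_prob (map f (joint_word w l j @ [Inr (length j)]))"
    by (rule word_prob_mset)
  also have "\<dots> = word_prob (joint_word w l j @ [Inr (length j)])"
    by (rule word_prob_map) (use assms(2) set_joint_word[OF assms(1)]
      in \<open>auto simp: inj_on_def f_def\<close>)
  finally show ?thesis .
qed

text \<open>
The total weight is preserved by a step. By the prediction rule the weight of the current state
splits into steps to old or new labels and into steps to unmatched sample clusters. Only the
step to the cluster next in order is allowed among the latter, and \<open>order_prob\<close> grows by exactly
the factor that compensates for the forbidden ones.
\<close>

lemma matching_step: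
  assumes "(l, j) \<in> matchings k T"
  defines "c \<equiv> Suc (card (set l))"
  shows "(\<Sum>a\<in>{1..c}. word_prob (joint_word w (l @ [a]) j) * order_prob ns (length j)) +
     (if length j < k then word_prob (joint_word w (l @ [c]) (j @ [c])) * order_prob ns (length (j
       @ [c])) else 0) =
     word_prob (joint_word w l j) * order_prob ns (length j)"
proof -
  let ?y = "joint_word w l j" and ?H = "order_prob ns"
  have l: "l \<in> rgs T" and jk: "length j \<le> k" using assms by (auto simp: matchings_def)
  have c: "c \<notin> set l" "{1..c} = insert c (set l)"
    unfolding c_def using set_rgs[OF l] by (metis atLeastAtMost_iff not_less_eq_eq order_refl)
      (metis set_rgs[OF l] atLeastAtMostSuc_conv le_add1 plus_1_eq_Suc)
  note sy = set_joint_word[OF assms(1)]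
  have cy: "Inl c \<notin> set ?y" using c(1) unfolding sy by auto
  have split: "word_prob ?y = (\<Sum>a\<in>{1..c}. word_prob (?y @ [Inl a])) +
     (\<Sum>i\<in>{length j..<k}. word_prob (?y @ [Inr i]))"
  proof -
    have "word_prob ?y = (\<Sum>x\<in>Inl ` set l \<union> Inr ` {length j..<k}. word_prob (?y @ [x])) +
      word_prob (?y @ [Inl c])"
      using word_prob_consistent[OF joint_word_nonempty cy] unfolding sy .
    also have "(\<Sum>x\<in>Inl ` set l \<union> Inr ` {length j..<k}. word_prob (?y @ [x])) =
      (\<Sum>a\<in>set l. word_prob (?y @ [Inl a])) + (\<Sum>i\<in>{length j..<k}. word_prob (?y @ [Inr i]))"
      by (subst sum.union_disjoint) (auto simp: sum.reindex)
    finally show ?thesis unfolding c(2) using c(1) by simp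
  qed
  \<comment> \<open>The factor common to all repetitions of a letter of the joint word.\<close>
  define Y where "Y = V (card (set ?y)) (Suc (length ?y)) *
     (\<Prod>a\<in>set ?y. pochhammer (1 - \<alpha>) (count_list ?y a - 1))"
  have Inr: "word_prob (?y @ [Inr i]) = (real (ns ! i) - \<alpha>) * Y" if "i \<in> {length j..<k}" for i
    using word_prob_snoc_old[of "Inr i" ?y] that sy count_joint_word_Inr[OF that]
    by (simp add: Y_def)
  have "?H (length j) * (\<Sum>i\<in>{length j..<k}. word_prob (?y @ [Inr i])) =
     Y * (?H (length j) * (\<Sum>i\<in>{length j..<k}. real (ns ! i) - \<alpha>))"
    by (simp add: Inr sum_distrib_left mult_ac)
  also have "\<dots> = (if length j < k
     then word_prob (joint_word w (l @ [c]) (j @ [c])) * ?H (length (j @ [c])) else 0)"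
  proof (cases "length j < k")
    case True
    then show ?thesis
      using order_prob_Suc[OF ns_ge_1, of "length j"] Inr[of "length j"]
      by (simp add: word_prob_joint_word_match[OF assms(1) c(1)] length_ns mult_ac)
  qed simp
  finally show ?thesis
    using split by (simp add: word_prob_joint_word_snoc sum_distrib_right[symmetric]
      sum_distrib_left[symmetric] algebra_simps)
qed

lemma matching_total:
  "(\<Sum>(l, j)\<in>matchings k T. word_prob (joint_word w l j) * order_prob ns (length j)) =
   word_prob w * order_prob ns 0"
proof (induction T)
  case 0
  have "joint_word w [] [] = map Inr w" by (simp add: joint_word_def letter_def)
  then show ?case by (simp add: matchings_0 word_prob_map)
next
  case (Suc T)
  show ?case
    unfolding sum_matchings_Suc Suc[symmetric]
    by (intro sum.cong refl) (use matching_step in auto)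
qed

lemma joint_word_complete:
  assumes "length j = k"
  shows "word_prob (joint_word w l j) = word_prob (l @ map ((!) j) w)"
proof -
  have "map (letter j) w = map (\<lambda>i. Inl (j ! i)) w"
    using assms set_w by (auto simp: letter_def)
  then have "joint_word w l j = map Inl (l @ map ((!) j) w)"
    by (simp add: joint_word_def)
  then show ?thesis by (simp only: word_prob_map inj_Inl)
qed

text \<open>
The weight of the states in which all sample clusters have been matched. There the joint word is
an explored word followed by labels occurring in it.
\<close>

definition complete_prob :: "nat \<Rightarrow> real" where
  "complete_prob T = (\<Sum>(l, j) | (l, j) \<in> matchings k T \<and> length j =
    k. word_prob (l @ map ((!) j) w))"

lemma matching_total_split:
  "word_prob w * order_prob ns 0 = complete_prob T +
   (\<Sum>(l, j) | (l, j) \<in> matchings k T \<and> length j < k. word_prob (joint_word w l j) *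
     order_prob ns (length j))"
proof -
  let ?f = "\<lambda>(l, j). word_prob (joint_word w l j) * order_prob ns (length j)"
  let ?C = "{(l, j). (l, j) \<in> matchings k T \<and> length j = k}"
  let ?I = "{(l, j). (l, j) \<in> matchings k T \<and> length j < k}"
  have fin: "finite ?C" "finite ?I" by (auto intro: finite_subset[OF _ finite_matchings[of k T]])
  have union: "?C \<union> ?I = matchings k T" by (auto simp: matchings_def)
  have "sum ?f (?C \<union> ?I) = sum ?f ?C + sum ?f ?I"
    by (rule sum.union_disjoint[OF fin]) auto
  then have "sum ?f (matchings k T) = sum ?f ?C + sum ?f ?I"
    unfolding union .
  moreover have "sum ?f ?C = complete_prob T"
    unfolding complete_prob_def
    by (intro sum.cong refl) (auto simp: joint_word_complete order_prob_def length_ns)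
  ultimately show ?thesis using matching_total[of T] by simp
qed

lemma complete_prob_le: "complete_prob T \<le> word_prob w * order_prob ns 0"
  unfolding matching_total_split[of T]
  by (auto intro!: sum_nonneg mult_nonneg_nonneg less_imp_le[OF word_prob_pos]
      less_imp_le[OF order_prob_bounds(1)] joint_word_nonempty ns_ge_1[rule_format])

text \<open>
If cluster \<open>s\<close> is still unmatched, its first occurrence can be moved right behind the explored
word, where it is a new letter, and the other letters of unmatched clusters can be moved next to
it and dropped. Distinct matchings of the first \<open>s\<close> clusters give distinct continuations by old
letters, so that their weights add up to at most the weight of that prefix.
\<close>

lemma incomplete_bound:
  assumes l: "l \<in> rgs T" and s: "s < k"
  shows "(\<Sum>j | sorted_wrt (<) j \<and> set j \<subseteq> set l \<and> length j = s. word_prob (joint_word w l j)) \<le>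
    word_prob (l @ [Suc (card (set l))])"
proof -
  let ?J = "{j. sorted_wrt (<) j \<and> set j \<subseteq> set l \<and> length j = s}"
  define u :: "(nat + nat) list" where "u = map Inl l @ map Inr (filter (\<lambda>i. s \<le> i) w)"
  define v :: "nat list \<Rightarrow> (nat + nat) list" where "v j =
    map (\<lambda>i. Inl (j ! i)) (filter (\<lambda>i. i < s) w)" for j
  have sw: "s \<in> set (filter (\<lambda>i. s \<le> i) w)" using s set_w by auto
  then have u_ne: "u \<noteq> []" by (metis Nil_is_append_conv Nil_is_map_conv empty_iff empty_set u_def)
  define F where "F = filter (\<lambda>i. s \<le> i) w"
  have mset_F: "mset F = add_mset s (mset (remove1 s F))"
    using sw unfolding F_def[symmetric] by simp
  have mset_v: "mset (joint_word w l j) = mset (u @ v j)" if "j \<in> ?J" for j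
  proof -
    have "mset (map (letter j) w) = mset (map (letter j) (filter (\<lambda>i. s \<le>
      i) w)) + mset (map (letter j) (filter (\<lambda>i. \<not> s \<le> i) w))"
      unfolding mset_map image_mset_union[symmetric] mset_filter multiset_partition[symmetric] ..
    also have "map (letter j) (filter (\<lambda>i. s \<le> i) w) = map Inr (filter (\<lambda>i. s \<le> i) w)"
      using that by (auto simp: letter_def)
    also have "map (letter j) (filter (\<lambda>i. \<not> s \<le> i) w) = v j"
      using that by (auto simp: letter_def v_def not_le)
    finally show ?thesis by (simp add: joint_word_def u_def)
  qed
  have inj: "inj_on v ?J"
  proof (rule inj_onI)
    fix j j' assume j: "j \<in> ?J" and j': "j' \<in> ?J" and eq: "v j = v j'"
    show "j = j'"
    proof (rule nth_equalityI)
      fix i assume "i < length j"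
      then have "i \<in> set (filter (\<lambda>i. i < s) w)" using j s set_w by auto
      then show "j ! i = j' ! i" using eq unfolding v_def map_eq_conv by blast
    qed (use j j' in simp)
  qed
  have "(\<Sum>j\<in>?J. word_prob (joint_word w l j)) = (\<Sum>j\<in>?J. word_prob (u @ v j))"
    by (intro sum.cong refl word_prob_mset mset_v)
  also have "\<dots> = (\<Sum>x\<in>v ` ?J. word_prob (u @ x))"
    by (simp add: sum.reindex[OF inj])
  also have "\<dots> \<le> (\<Sum>x | set x \<subseteq> set u \<and> length x = length (filter (\<lambda>i. i < s) w). word_prob (u @ x))"
  proof (rule sum_mono2)
    show "v ` ?J \<subseteq> {x. set x \<subseteq> set u \<and> length x = length (filter (\<lambda>i. i < s) w)}"
      by (auto simp: u_def v_def) (meson imageI nth_mem subsetD)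
    show "0 \<le> word_prob (u @ x)" for x
      using u_ne by (intro less_imp_le[OF word_prob_pos]) simp
  qed (simp add: finite_lists_length_eq)
  also have "\<dots> \<le> word_prob u"
    by (rule sum_word_prob_append_le[OF u_ne]) (rule infinite_UNIV_sum_nat)
  also have "\<dots> = word_prob ((map Inl l @ [Inr s]) @ map Inr (remove1 s F))"
    by (rule word_prob_mset) (simp add: u_def F_def[symmetric] mset_F del: mset_remove1)
  also have "\<dots> \<le> word_prob (map Inl l @ [Inr s])"
    by (rule word_prob_append_le) (simp_all add: infinite_UNIV_sum_nat)
  also have "\<dots> = word_prob (map (case_sum id (\<lambda>_. Suc (card (set l)))) (map Inl l @ [Inr s]))"
  proof (rule word_prob_map[symmetric])
    have "Suc (card (set l)) \<notin> set l"
      using set_rgs[OF l] by (metis atLeastAtMost_iff not_less_eq_eq order_refl)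
    then show "inj_on (case_sum id (\<lambda>_. Suc (card (set l)))) (set (map Inl l @ [Inr s]))"
      by (auto simp: inj_on_def)
  qed
  also have "map (case_sum id (\<lambda>_. Suc (card (set l)))) (map Inl l @ [Inr s]) =
    l @ [Suc (card (set l))]"
    by (simp add: o_def)
  finally show ?thesis .
qed

text \<open>
The conserved total exceeds the complete matchings by the partial ones. For each of the \<open>k\<close>
possible numbers of matched clusters these weigh at most the probability that step \<open>T + 1\<close> of
the exploration opens a new cluster.
\<close>

lemma complete_prob_ge:
  "word_prob w * order_prob ns 0 \<le>
   complete_prob T + real k * (\<Sum>l\<in>rgs T. word_prob (l @ [Suc (card (set l))]))"
proof -
  let ?J = "\<lambda>l s. {j. sorted_wrt (<) j \<and> set j \<subseteq> set l \<and> length j = s}"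
  let ?I = "{(l, j). (l, j) \<in> matchings k T \<and> length j < k}"
  have I: "?I = (SIGMA l:rgs T. \<Union>s\<in>{..<k}. ?J l s)" by (auto simp: matchings_def)
  have finJ: "finite (?J l s)" for l s
    by (rule finite_subset[OF _ finite_lists_length_eq[of "set l" s]]) auto
  have "(\<Sum>(l, j)\<in>?I. word_prob (joint_word w l j) * order_prob ns (length j)) \<le>
        (\<Sum>(l, j)\<in>?I. word_prob (joint_word w l j))"
    using order_prob_bounds(2)[OF ns_ge_1] word_prob_pos[OF joint_word_nonempty]
    by (intro sum_mono) (auto intro!: mult_left_le intro: less_imp_le)
  also have "\<dots> = (\<Sum>l\<in>rgs T. \<Sum>j\<in>(\<Union>s\<in>{..<k}. ?J l s). word_prob (joint_word w l j))"
    unfolding I using finJ by (subst sum.Sigma) (auto simp: finite_rgs)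
  also have "\<dots> = (\<Sum>l\<in>rgs T. \<Sum>s\<in>{..<k}. \<Sum>j\<in>?J l s. word_prob (joint_word w l j))"
    using finJ by (intro sum.cong refl sum.UNION_disjoint) auto
  also have "\<dots> \<le> (\<Sum>l\<in>rgs T. \<Sum>s\<in>{..<k}. word_prob (l @ [Suc (card (set l))]))"
    by (intro sum_mono incomplete_bound) auto
  also have "\<dots> = real k * (\<Sum>l\<in>rgs T. word_prob (l @ [Suc (card (set l))]))"
    by (simp add: sum_distrib_left)
  finally show ?thesis unfolding matching_total_split[of T] by simp
qed

end

section \<open>Mixed moments of the size-biased frequencies\<close>

locale gibbs_frequencies = prob_space M + gibbs \<alpha> V
  for M :: "'a measure" and \<alpha> V +
  fixes R :: "nat \<Rightarrow> 'a \<Rightarrow> nat set set" and P :: "nat \<Rightarrow> 'a \<Rightarrow> real"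
  assumes partition: "gibbs_partition M \<alpha> V R"
    and frequencies: "size_biased_frequencies M R P"
    and proper: "proper_frequencies M P"
begin

text \<open>
The empty word gets the whole space, since nothing is known of \<open>R 0\<close>.
\<close>

definition coded_by :: "nat list \<Rightarrow> 'a set" where
  "coded_by l = {\<omega> \<in> space M. l = [] \<or> R (length l) \<omega> = word_partition l}"

lemma random_partition: "random_partition M R"
  using partition by (auto simp: gibbs_partition_def exchangeable_partition_eppf_def)

lemma R_measurable: "1 \<le> n \<Longrightarrow> R n \<in> measurable M (count_space {\<pi>. partition_on {1..n} \<pi>})"
  using random_partition by (simp add: random_partition_def)

lemma R_partition_on: "1 \<le> n \<Longrightarrow> \<omega> \<in> space M \<Longrightarrow> partition_on {1..n} (R n \<omega>)"
  using measurable_space[OF R_measurable] by simp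

lemma R_restrict: "1 \<le> m \<Longrightarrow> m < n \<Longrightarrow> \<omega> \<in> space M \<Longrightarrow> R m \<omega> = restrict_partition m (R n \<omega>)"
  using random_partition by (simp add: random_partition_def)

lemma length_pos_iff: "l \<noteq> [] \<longleftrightarrow> 1 \<le> length l"
  by (cases l) auto

lemma coded_by_sets [measurable]: "coded_by l \<in> sets M"
proof (cases "l = []")
  case True
  then show ?thesis by (simp add: coded_by_def)
next
  case False
  have "R (length l) -` {word_partition l} \<inter> space M \<in> sets M"
    by (rule measurable_sets[OF R_measurable])
      (use False partition_on_word_partition[of l] in \<open>auto simp: length_pos_iff\<close>)
  moreover have "R (length l) -` {word_partition l} \<inter> space M = coded_by l"
    using False by (auto simp: coded_by_def)
  ultimately show ?thesis by simp
qed

lemma coded_by_space: "\<omega> \<in> coded_by l \<Longrightarrow> \<omega> \<in> space M"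
  by (simp add: coded_by_def)

lemma coded_by_snoc_subset: "coded_by (l @ [a]) \<subseteq> coded_by l"
proof
  fix \<omega> assume \<omega>: "\<omega> \<in> coded_by (l @ [a])"
  then show "\<omega> \<in> coded_by l"
  proof (cases "l = []")
    case False
    then show ?thesis
      using \<omega> R_restrict[of "length l" "Suc (length l)" \<omega>] restrict_partition_word_partition[of l a]
      by (simp add: coded_by_def length_pos_iff)
  qed (simp add: coded_by_def)
qed

lemma coded_by_extend:
  assumes "l \<in> rgs T" "\<omega> \<in> coded_by l"
  shows "\<exists>a\<in>{1..Suc (card (set l))}. \<omega> \<in> coded_by (l @ [a])"
proof -
  have \<omega>: "\<omega> \<in> space M" using assms(2) by (rule coded_by_space)
  have part: "partition_on {1..Suc T} (R (Suc T) \<omega>)" using R_partition_on[of "Suc T" \<omega>] \<omega> by simp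
  have "restrict_partition T (R (Suc T) \<omega>) = word_partition l"
  proof (cases "T = 0")
    case True
    then show ?thesis using assms(1) by (simp add: restrict_partition_def word_partition_def) blast
  next
    case False
    then have "R T \<omega> = word_partition l" using assms length_rgs[OF assms(1)]
      by (auto simp: coded_by_def)
    then show ?thesis using R_restrict[of T "Suc T" \<omega>] False \<omega> by simp
  qed
  from word_partition_extend[OF assms(1) part this] show ?thesis
    using \<omega> length_rgs[OF assms(1)] by (simp add: coded_by_def)
qed

lemma coded_by_exists:
  assumes "\<omega> \<in> space M"
  shows "\<exists>l\<in>rgs T. \<omega> \<in> coded_by l"
proof (induction T)
  case 0
  then show ?case using assms by (simp add: coded_by_def)
next
  case (Suc T)
  then obtain l where l: "l \<in> rgs T" "\<omega> \<in> coded_by l" by blast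
  then obtain a where "a \<in> {1..Suc (card (set l))}" "\<omega> \<in> coded_by (l @ [a])"
    using coded_by_extend by blast
  then show ?case using l snoc_rgs_iff[of l a T] by blast
qed

lemma coded_by_unique:
  assumes "l \<in> rgs T" "l' \<in> rgs T" "\<omega> \<in> coded_by l" "\<omega> \<in> coded_by l'"
  shows "l = l'"
  using assms
proof (induction T arbitrary: l l')
  case (Suc T)
  obtain k a k' a' where l: "l = k @ [a]" "k \<in> rgs T" "a \<in> {1..Suc (card (set k))}"
    and l': "l' = k' @ [a']" "k' \<in> rgs T" "a' \<in> {1..Suc (card (set k'))}"
    using Suc.prems(1,2) by auto
  have "k = k'"
    using Suc.IH[OF l(2) l'(2)] coded_by_snoc_subset Suc.prems(3,4) l(1) l'(1) by blast
  moreover have "word_partition (k @ [a]) = word_partition (k' @ [a'])"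
    using Suc.prems(3,4) l l' length_rgs[OF l(2)] length_rgs[OF l'(2)] by (simp add: coded_by_def)
  ultimately show ?case using word_partition_snoc_inj[OF l(2)] l l' by metis
qed simp

lemma sum_indicator_coded_by:
  assumes "l \<in> rgs T" "\<omega> \<in> coded_by l"
  shows "(\<Sum>l\<in>rgs T. indicator (coded_by l) \<omega> * g l) = (g l :: real)"
proof -
  have "\<omega> \<notin> coded_by l'" if "l' \<in> rgs T - {l}" for l'
    using that assms coded_by_unique by blast
  then have "(\<Sum>l\<in>rgs T. indicator (coded_by l) \<omega> * g l) = (\<Sum>l\<in>{l}. indicator (coded_by l) \<omega> * g l)"
    using assms(1) by (intro sum.mono_neutral_right) (simp_all add: finite_rgs)
  then show ?thesis using assms(2) by simp
qed

lemma indicator_coded_by_extend: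
  assumes "l \<in> rgs T" "\<omega> \<in> space M"
  shows "(indicator (coded_by l) \<omega> :: real) =
    (\<Sum>a\<in>{1..Suc (card (set l))}. indicator (coded_by (l @ [a])) \<omega>)"
proof (cases "\<omega> \<in> coded_by l")
  case True
  then obtain a where a: "a \<in> {1..Suc (card (set l))}" "\<omega> \<in> coded_by (l @ [a])"
    using coded_by_extend[OF assms(1)] by blast
  have "\<omega> \<notin> coded_by (l @ [b])" if "b \<in> {1..Suc (card (set l))} - {a}" for b
    using coded_by_unique[of "l @ [b]" "Suc T" "l @ [a]"] that a assms(1) snoc_rgs_iff[of l _ T]
      by blast
  then have "(\<Sum>b\<in>{1..Suc (card (set l))}. indicator (coded_by (l @ [b])) \<omega> :: real) =
    (\<Sum>b\<in>{a}. indicator (coded_by (l @ [b])) \<omega>)"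
    using a(1) by (intro sum.mono_neutral_right) simp_all
  then show ?thesis using True a by simp
next
  case False
  then show ?thesis using coded_by_snoc_subset by (auto simp: indicator_def intro!: sum.neutral)
qed

text \<open>
For the empty word the two sides may differ, as \<open>V 0 0\<close> is unrelated to the weights; hence \<open>T\<close>
is positive.
\<close>

lemma prob_coded_by:
  assumes "l \<in> rgs T" "0 < T"
  shows "prob (coded_by l) = word_prob l"
proof -
  let ?ks = "[1..<Suc (card (set l))]"
  have s: "set ?ks = set l"
    using set_rgs[OF assms(1)] by (metis atLeastLessThanSuc_atLeastAtMost set_upt)
  have len: "length l = T" by (rule length_rgs[OF assms(1)])
  have ne: "l \<noteq> []" using assms len by auto
  obtain p where p: "exchangeable_partition_eppf M R p"
    "\<And>ns. ns \<in> compositions \<Longrightarrow>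
       p ns = V (length ns) (sum_list ns) * (\<Prod>m\<leftarrow>ns. pochhammer (1 - \<alpha>) (m - 1))"
    using partition by (auto simp: gibbs_partition_def)
  let ?Cs = "map (block l) ?ks"
  have set_Cs: "set ?Cs = word_partition l"
    by (simp only: set_map s word_partition_def)
  have "distinct ?Cs"
    using inj_on_block[of l] by (simp only: distinct_map s distinct_upt simp_thms)
  moreover have "partition_on {1..T} (set ?Cs)"
    using partition_on_word_partition[of l] unfolding set_Cs len .
  moreover have "\<P>(\<omega> in M. R T \<omega> = set Cs) = p (map card Cs)"
    if "distinct Cs" "partition_on {1..T} (set Cs)" for Cs
    using p(1) assms(2) that unfolding exchangeable_partition_eppf_def by auto
  ultimately have "\<P>(\<omega> in M. R T \<omega> = set ?Cs) = p (map card ?Cs)" by blast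
  moreover have "{\<omega> \<in> space M. R T \<omega> = set ?Cs} = coded_by l"
    unfolding set_Cs coded_by_def using ne len by auto
  ultimately have "prob (coded_by l) = p (map card ?Cs)" by simp
  also have "map card ?Cs = map (count_list l) ?ks"
    by (simp add: card_block del: upt_Suc)
  also have "p (map (count_list l) ?ks) =
    V (length (map (count_list l) ?ks)) (sum_list (map (count_list l) ?ks)) *
     (\<Prod>m\<leftarrow>map (count_list l) ?ks. pochhammer (1 - \<alpha>) (m - 1))"
  proof (rule p(2))
    have "?ks \<noteq> []" using ne s by (metis set_empty)
    moreover have "\<forall>a\<in>set ?ks. 1 \<le> count_list l a" unfolding s using count_list_pos by auto
    ultimately show "map (count_list l) ?ks \<in> compositions"
      by (simp add: compositions_def del: upt_Suc)
  qed
  also have "sum_list (map (count_list l) ?ks) = length l"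
    using sum_count_set[of l "set l"] s
    by (simp add: sum_list_distinct_conv_sum_set del: upt_Suc)
  also have "(\<Prod>m\<leftarrow>map (count_list l) ?ks. pochhammer (1 - \<alpha>) (m - 1)) =
      (\<Prod>a\<in>set l. pochhammer (1 - \<alpha>) (count_list l a - 1))"
    using s by (simp add: prod.distinct_set_conv_list[symmetric] o_def del: upt_Suc)
  also have "length (map (count_list l) ?ks) = card (set l)"
    by (simp del: upt_Suc)
  finally show ?thesis unfolding word_prob_def .
qed

lemma cluster_size_coded_by:
  assumes "l \<in> rgs T" "0 < T" "\<omega> \<in> coded_by l" "1 \<le> j"
  shows "cluster_size j (R T \<omega>) = count_list l j"
  using assms cluster_size_word_partition[OF assms(1,4)] length_rgs[OF assms(1)]
  by (auto simp: coded_by_def)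

lemma cluster_size_measurable:
  assumes "1 \<le> n"
  shows "(\<lambda>\<omega>. real (cluster_size j (R n \<omega>))) \<in> borel_measurable M"
  by (rule measurable_compose[OF R_measurable[OF assms]]) simp

lemma cluster_size_le:
  assumes "\<omega> \<in> space M" "1 \<le> j" "0 < n"
  shows "cluster_size j (R n \<omega>) \<le> n"
proof -
  obtain l where l: "l \<in> rgs n" "\<omega> \<in> coded_by l" using coded_by_exists[OF assms(1)] by blast
  then show ?thesis
    using cluster_size_coded_by[OF l(1) assms(3) l(2) assms(2)] count_le_length[of l j]
      length_rgs[OF l(1)]
    by simp
qed

lemma P_measurable: "1 \<le> j \<Longrightarrow> P j \<in> borel_measurable M"
  using frequencies by (simp add: size_biased_frequencies_def)

lemma AE_P_bounds: "AE \<omega> in M. \<forall>j\<ge>1. 0 < P j \<omega> \<and> P j \<omega> \<le> 1"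
  using proper unfolding proper_frequencies_def
proof eventually_elim
  case (elim \<omega>)
  have "P j \<omega> \<le> 1" if "1 \<le> j" for j
  proof -
    have "(\<Sum>i\<in>{j - 1}. P (Suc i) \<omega>) \<le> (\<Sum>i. P (Suc i) \<omega>)"
      by (rule sum_le_suminf) (use elim in \<open>auto simp: sums_iff intro: less_imp_le\<close>)
    then show ?thesis using elim that by (simp add: sums_iff)
  qed
  with elim show ?case by blast
qed

text \<open>
The conditional probability, given the frequencies, that a sample of length \<open>length ys\<close> equals
\<open>ys\<close>.
\<close>

definition word_freq :: "nat list \<Rightarrow> 'a \<Rightarrow> real" where
  "word_freq ys \<omega> = (\<Prod>y\<leftarrow>ys. P y \<omega>)"

lemma word_freq_measurable [measurable]:
  assumes "set ys \<subseteq> {1..}"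
  shows "word_freq ys \<in> borel_measurable M"
  using assms
proof (induction ys)
  case (Cons y ys)
  have "word_freq (y # ys) = (\<lambda>\<omega>. P y \<omega> * word_freq ys \<omega>)" by (simp add: word_freq_def fun_eq_iff)
  then show ?case using Cons P_measurable[of y] by simp
qed (simp add: word_freq_def[abs_def])

lemma AE_word_freq_bounds:
  assumes "set ys \<subseteq> {1..}"
  shows "AE \<omega> in M. 0 \<le> word_freq ys \<omega> \<and> word_freq ys \<omega> \<le> 1"
  using AE_P_bounds
proof eventually_elim
  case (elim \<omega>)
  show ?case using assms
  proof (induction ys)
    case (Cons y ys)
    then show ?case using elim
      by (auto simp: word_freq_def less_imp_le intro!: mult_le_one)
  qed (simp add: word_freq_def)
qed

lemma integrable_bounded:
  assumes "f \<in> borel_measurable M" "AE \<omega> in M. \<bar>f \<omega>\<bar> \<le> B"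
  shows "integrable M (f :: 'a \<Rightarrow> real)"
  by (rule integrable_const_bound[of f B]) (use assms in auto)

text \<open>
Given that the partition of \<open>{1..T}\<close> is coded by \<open>l\<close>, a draw from the frequencies that hits the
label \<open>x\<close> of \<open>l\<close> has the same weight as finding \<open>T + 1\<close> in cluster \<open>x\<close>. By exchangeability every
later element is as likely as \<open>T + 1\<close> to be in cluster \<open>x\<close>, jointly with the remaining draws
\<open>ys\<close>; averaging over these elements and letting their number grow turns the indicator into \<open>P
x\<close>. The induction on \<open>ys\<close> supplies the exchangeability for the limiting quantity \<open>word_freq ys\<close>,
as it reduces to that of \<open>word_prob\<close>.
\<close>

lemma expectation_coded_by_word_freq:
  assumes "l \<in> rgs T" "0 < T" "set ys \<subseteq> set l"
  shows "expectation (\<lambda>\<omega>. indicator (coded_by l) \<omega> * word_freq ys \<omega>) = word_prob (l @ ys)"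
  using assms
proof (induction ys arbitrary: l T)
  case Nil
  then show ?case by (simp add: word_freq_def prob_coded_by)
next
  case (Cons x ys)
  define C where "C n \<omega> = real (cluster_size x (R n \<omega>))" for n \<omega>
  have x1: "1 \<le> x" and ys1: "set ys \<subseteq> {1..}"
    using Cons.prems set_rgs[OF Cons.prems(1)] by (auto simp: subset_iff)
  have C_meas [measurable]: "C n \<in> borel_measurable M" if "1 \<le> n" for n
    unfolding C_def[abs_def] using cluster_size_measurable[OF that] .
  note [measurable] = word_freq_measurable[OF ys1]
  have C_bounds: "0 \<le> C n \<omega> \<and> C n \<omega> \<le> real n" if "\<omega> \<in> space M" "1 \<le> n" for n \<omega>
    using cluster_size_le[OF that(1) x1, of n] that(2) by (simp add: C_def)
  have intgr: "integrable M (\<lambda>\<omega>. indicator (coded_by l) \<omega> * ((C n \<omega> - C m \<omega>) * word_freq ys \<omega>))"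
    if "1 \<le> n" "1 \<le> m" for l n m
  proof (rule integrable_bounded)
    show "AE \<omega> in M. \<bar>indicator (coded_by l) \<omega> * ((C n \<omega> - C m \<omega>) * word_freq ys \<omega>)\<bar> \<le>
      real n + real m"
      using AE_word_freq_bounds[OF ys1] AE_space
    proof eventually_elim
      case (elim \<omega>)
      have "\<bar>C n \<omega> - C m \<omega>\<bar> \<le> real n + real m"
        using C_bounds[of \<omega> n] C_bounds[of \<omega> m] elim that by linarith
      then have "\<bar>(C n \<omega> - C m \<omega>) * word_freq ys \<omega>\<bar> \<le> (real n + real m) * 1"
        unfolding abs_mult using elim by (intro mult_mono) auto
      then show ?case by (simp add: indicator_def)
    qed
  qed (use that in measurable)
  \<comment> \<open>The increment of \<open>C\<close> at time \<open>T + N + 1\<close> is the indicator that this element joins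
    cluster \<open>x\<close>. The induction on \<open>N\<close> conditions on the cluster \<open>a\<close> of element \<open>T + 1\<close> and exchanges
    the letters \<open>a\<close> and \<open>x\<close>.\<close>
  have step: "expectation (\<lambda>\<omega>. indicator (coded_by l) \<omega> * ((C (T + Suc N) \<omega> - C (T + N) \<omega>) *
    word_freq ys \<omega>)) =
      word_prob (l @ x # ys)"
    if "l \<in> rgs T" "0 < T" "x \<in> set l" "set ys \<subseteq> set l" for N l T
    using that
  proof (induction N arbitrary: l T)
    case (0 l T)
    let ?K = "Suc (card (set l))"
    have xK: "x \<in> {1..?K}" using 0 set_rgs[OF 0(1)] by (metis atLeastAtMost_iff le_SucI)
    have lx: "l @ [x] \<in> rgs (Suc T)" using 0 xK snoc_rgs_iff by blast
    have "indicator (coded_by l) \<omega> * (C (T + Suc 0) \<omega> - C (T + 0) \<omega>) =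
      indicator (coded_by (l @ [x])) \<omega>"
      if "\<omega> \<in> space M" for \<omega>
    proof (cases "\<omega> \<in> coded_by l")
      case True
      then obtain a where a: "a \<in> {1..?K}" "\<omega> \<in> coded_by (l @ [a])"
        using coded_by_extend[OF 0(1)] by blast
      have la: "l @ [a] \<in> rgs (Suc T)" using 0 a snoc_rgs_iff by blast
      have "C (Suc T) \<omega> = real (count_list (l @ [a]) x)"
        unfolding C_def using cluster_size_coded_by[OF la _ a(2) x1] by simp
      moreover have "C T \<omega> = real (count_list l x)"
        unfolding C_def using cluster_size_coded_by[OF 0(1) 0(2) True x1] by simp
      moreover have "\<omega> \<in> coded_by (l @ [x]) \<longleftrightarrow> a = x"
        using coded_by_unique[OF la lx a(2)] a(2) by auto
      ultimately show ?thesis using True by (auto simp: indicator_def)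
    next
      case False
      then show ?thesis using coded_by_snoc_subset[of l x] by (auto simp: indicator_def)
    qed
    then have "expectation (\<lambda>\<omega>. indicator (coded_by l) \<omega> * ((C (T + Suc 0) \<omega> - C (T + 0) \<omega>) *
      word_freq ys \<omega>)) =
      expectation (\<lambda>\<omega>. indicator (coded_by (l @ [x])) \<omega> * word_freq ys \<omega>)"
      by (intro Bochner_Integration.integral_cong refl) (simp add: mult.assoc[symmetric])
    also have "\<dots> = word_prob ((l @ [x]) @ ys)"
      by (rule Cons.IH[OF lx]) (use 0 in auto)
    finally show ?case by simp
  next
    case (Suc N l T)
    let ?K = "Suc (card (set l))"
    have xK: "x \<in> {1..?K}" using Suc set_rgs[OF Suc.prems(1)] by (metis atLeastAtMost_iff le_SucI)
    have lx: "l @ [x] \<in> rgs (Suc T)" using Suc.prems xK snoc_rgs_iff by blast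
    have K: "Suc (card (set (l @ [x]))) = ?K" using Suc.prems by (simp add: insert_absorb)
    let ?D = "\<lambda>\<omega>. (C (T + Suc (Suc N)) \<omega> - C (T + Suc N) \<omega>) * word_freq ys \<omega>"
    have "expectation (\<lambda>\<omega>. indicator (coded_by l) \<omega> * ?D \<omega>) =
      expectation (\<lambda>\<omega>. \<Sum>a\<in>{1..?K}. indicator (coded_by (l @ [a])) \<omega> * ?D \<omega>)"
      by (intro Bochner_Integration.integral_cong refl)
        (simp only: indicator_coded_by_extend[OF Suc.prems(1)] sum_distrib_right)
    also have "\<dots> = (\<Sum>a\<in>{1..?K}. expectation (\<lambda>\<omega>. indicator (coded_by (l @ [a])) \<omega> * ?D \<omega>))"
      by (rule Bochner_Integration.integral_sum) (rule intgr, simp_all)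
    also have "\<dots> = (\<Sum>a\<in>{1..?K}. word_prob ((l @ [a]) @ x # ys))"
    proof (intro sum.cong refl)
      fix a assume a: "a \<in> {1..?K}"
      have "l @ [a] \<in> rgs (Suc T)" using Suc.prems a snoc_rgs_iff by blast
      from Suc.IH[OF this] Suc.prems show "expectation (\<lambda>\<omega>. indicator (coded_by (l @ [a])) \<omega> *
        ?D \<omega>) = word_prob ((l @ [a]) @ x # ys)"
        by (simp add: subset_insertI2)
    qed
    also have "\<dots> = (\<Sum>a\<in>{1..?K}. word_prob (((l @ [x]) @ [a]) @ ys))"
      by (intro sum.cong refl word_prob_mset) simp
    also have "\<dots> = (\<Sum>a\<in>{1..?K}. expectation (\<lambda>\<omega>. indicator (coded_by ((l @ [x]) @ [a])) \<omega> *
      word_freq ys \<omega>))"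
    proof (intro sum.cong refl)
      fix a assume a: "a \<in> {1..?K}"
      have "(l @ [x]) @ [a] \<in> rgs (Suc (Suc T))" using lx a K snoc_rgs_iff by metis
      from Cons.IH[OF this] Suc.prems show "word_prob (((l @ [x]) @ [a]) @ ys) =
        expectation (\<lambda>\<omega>. indicator (coded_by ((l @ [x]) @ [a])) \<omega> * word_freq ys \<omega>)"
        by (simp add: subset_insertI2)
    qed
    also have "\<dots> = expectation (\<lambda>\<omega>. \<Sum>a\<in>{1..?K}. indicator (coded_by ((l @ [x]) @ [a])) \<omega> *
      word_freq ys \<omega>)"
    proof (rule Bochner_Integration.integral_sum[symmetric], rule integrable_bounded)
      fix a show "AE \<omega> in M. \<bar>indicator (coded_by ((l @ [x]) @ [a])) \<omega> * word_freq ys \<omega>\<bar> \<le> 1"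
        using AE_word_freq_bounds[OF ys1] by eventually_elim (simp add: indicator_def)
    qed measurable
    also have "\<dots> = expectation (\<lambda>\<omega>. indicator (coded_by (l @ [x])) \<omega> * word_freq ys \<omega>)"
      by (intro Bochner_Integration.integral_cong refl)
        (simp only: indicator_coded_by_extend[OF lx] K sum_distrib_right)
    also have "\<dots> = word_prob ((l @ [x]) @ ys)"
      by (rule Cons.IH[OF lx]) (use Suc.prems in auto)
    finally show ?case by simp
  qed
  have x: "x \<in> set l" and ysl: "set ys \<subseteq> set l" using Cons.prems(3) by auto
  let ?f = "\<lambda>N \<omega>. indicator (coded_by l) \<omega> * ((C (T + Suc N) \<omega> - C T \<omega>) * word_freq ys \<omega>)"
  have sum_eq: "expectation (?f N) = real (Suc N) * word_prob (l @ x # ys)" for N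
  proof -
    have tel: "?f N \<omega> = (\<Sum>i<Suc N. indicator (coded_by l) \<omega> * ((C (T + Suc i) \<omega> - C (T + i) \<omega>) *
      word_freq ys \<omega>))" for \<omega>
      unfolding sum_distrib_left[symmetric] sum_distrib_right[symmetric]
      by (subst sum_lessThan_telescope[of "\<lambda>i. C (T + i) \<omega>"]) simp
    have "expectation (?f N) = (\<Sum>i<Suc N. expectation (\<lambda>\<omega>. indicator (coded_by l) \<omega> * ((C (T +
      Suc i) \<omega> - C (T + i) \<omega>) * word_freq ys \<omega>)))"
      unfolding tel by (rule Bochner_Integration.integral_sum) (rule intgr, use Cons.prems(2)
        in auto)
    also have "\<dots> = (\<Sum>i<Suc N. word_prob (l @ x # ys))"
      by (intro sum.cong refl step[OF Cons.prems(1,2) x ysl])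
    finally show ?thesis by simp
  qed
  have "(\<lambda>N. expectation (\<lambda>\<omega>. ?f N \<omega> / real (Suc N))) \<longlonglongrightarrow>
    expectation (\<lambda>\<omega>. indicator (coded_by l) \<omega> * word_freq (x # ys) \<omega>)"
  \<comment> \<open>A cluster of a partition of \<open>{1..n}\<close> has at most \<open>n\<close> elements, which gives the bound.\<close>
  proof (rule integral_dominated_convergence[where w = "\<lambda>_. 2 * real T + 1"])
    have "set (x # ys) \<subseteq> {1..}" using x1 ys1 by simp
    note [measurable] = word_freq_measurable[OF this]
    show "(\<lambda>\<omega>. indicator (coded_by l) \<omega> * word_freq (x # ys) \<omega>) \<in> borel_measurable M" by measurable
    show "(\<lambda>\<omega>. ?f N \<omega> / real (Suc N)) \<in> borel_measurable M" for N
      using intgr[of "T + Suc N" T l] Cons.prems(2) by (auto dest: borel_measurable_integrable)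
    show "integrable M (\<lambda>_. 2 * real T + 1)" by simp
    have "AE \<omega> in M. (\<lambda>n. C n \<omega> / real n) \<longlonglongrightarrow> P x \<omega>"
      using frequencies x1 unfolding size_biased_frequencies_def C_def by blast
    then show "AE \<omega> in M. (\<lambda>N. ?f N \<omega> / real (Suc N)) \<longlonglongrightarrow>
      indicator (coded_by l) \<omega> * word_freq (x # ys) \<omega>"
    proof eventually_elim
      case (elim \<omega>)
      have "(\<lambda>N. C (N + Suc T) \<omega> / real (N + Suc T)) \<longlonglongrightarrow> P x \<omega>"
        by (rule LIMSEQ_ignore_initial_segment[OF elim])
      moreover have lim0: "(\<lambda>N. c / real (Suc N)) \<longlonglongrightarrow> 0" for c
        by (rule LIMSEQ_Suc[OF lim_const_over_n])
      have "(\<lambda>N. 1 + real T / real (Suc N)) \<longlonglongrightarrow> 1 + 0"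
        by (intro tendsto_intros lim0)
      then have "(\<lambda>N. real (N + Suc T) / real (Suc N)) \<longlonglongrightarrow> 1"
        by (simp add: field_simps)
      moreover note lim0[of "C T \<omega>"]
      ultimately have "(\<lambda>N. (C (N + Suc T) \<omega> / real (N + Suc T)) * (real (N + Suc T) / real (Suc
        N)) - C T \<omega> / real (Suc N)) \<longlonglongrightarrow> P x \<omega> * 1 - 0"
        by (intro tendsto_intros)
      then have "(\<lambda>N. indicator (coded_by l) \<omega> * (((C (N + Suc T) \<omega> / real (N + Suc T)) *
        (real (N + Suc T) / real (Suc N)) - C T \<omega> / real (Suc N)) * word_freq ys \<omega>)) \<longlonglongrightarrow>
        indicator (coded_by l) \<omega> * ((P x \<omega> * 1 - 0) * word_freq ys \<omega>)"
        by (intro tendsto_mult tendsto_const)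
      moreover have "indicator (coded_by l) \<omega> * ((P x \<omega> * 1 - 0) * word_freq ys \<omega>) =
        indicator (coded_by l) \<omega> * word_freq (x # ys) \<omega>"
        by (simp add: word_freq_def)
      moreover have "indicator (coded_by l) \<omega> * (((C (N + Suc T) \<omega> / real (N + Suc T)) *
        (real (N + Suc T) / real (Suc N)) - C T \<omega> / real (Suc N)) * word_freq ys \<omega>) =
          ?f N \<omega> / real (Suc N)" for N
        by (simp add: add.commute[of N] flip: diff_divide_distrib)
      ultimately show ?case by (simp only:)
    qed
    show "AE \<omega> in M. norm (?f N \<omega> / real (Suc N)) \<le> 2 * real T + 1" for N
      using AE_word_freq_bounds[OF ys1] AE_space
    proof eventually_elim
      case (elim \<omega>)
      have "\<bar>C (T + Suc N) \<omega> - C T \<omega>\<bar> \<le> 2 * real T + real (Suc N)"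
        using C_bounds[of \<omega> "T + Suc N"] C_bounds[of \<omega> T] elim Cons.prems(2) by auto
      also have "\<dots> \<le> (2 * real T + 1) * real (Suc N)"
        by (simp add: algebra_simps)
      finally have "\<bar>(C (T + Suc N) \<omega> - C T \<omega>) * word_freq ys \<omega>\<bar> \<le>
        (2 * real T + 1) * real (Suc N) * 1"
        unfolding abs_mult using elim by (intro mult_mono) auto
      then have "\<bar>?f N \<omega>\<bar> \<le> (2 * real T + 1) * real (Suc N)"
        by (auto simp: indicator_def)
      then show ?case by (simp add: divide_le_eq)
    qed
  qed
  moreover have "expectation (\<lambda>\<omega>. ?f N \<omega> / real (Suc N)) = word_prob (l @ x # ys)" for N
    using sum_eq[of N] by simp
  ultimately show ?case using LIMSEQ_unique[OF _ tendsto_const] by simp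
qed

definition mean_freq :: "nat list \<Rightarrow> real" where
  "mean_freq x = expectation (word_freq x)"

text \<open>
The codes of those partitions of \<open>{1..T}\<close> in which all the clusters labelled by \<open>x\<close> have already
appeared.
\<close>

definition covering :: "nat \<Rightarrow> nat list \<Rightarrow> nat list set" where
  "covering T x = {l \<in> rgs T. set x \<subseteq> set l}"

text \<open>
The sum is the expectation of \<open>word_freq x\<close> on the event that the clusters of \<open>x\<close> have appeared
by time \<open>T\<close>. As all \<open>P y\<close> are positive, this event eventually occurs almost surely.
\<close>

lemma covering_word_prob:
  fixes x
  assumes "set x \<subseteq> {1..}"
  shows covering_word_prob_le: "0 < T \<Longrightarrow> (\<Sum>l\<in>covering T x. word_prob (l @ x)) \<le> mean_freq x"
    and covering_word_prob_tendsto: "(\<lambda>T. \<Sum>l\<in>covering T x. word_prob (l @ x)) \<longlonglongrightarrow> mean_freq x"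
proof -
  note [measurable] = word_freq_measurable[OF assms]
  define G where "G T \<omega> = (\<Sum>l\<in>rgs T. indicator (coded_by l) \<omega> * (of_bool (set x \<subseteq> set l) *
    word_freq x \<omega>))" for T \<omega>
  have G_meas [measurable]: "G T \<in> borel_measurable M" for T
    unfolding G_def[abs_def] by measurable
  have G_eq: "G T \<omega> = of_bool (\<forall>y\<in>set x. 0 < cluster_size y (R T \<omega>)) * word_freq x \<omega>"
    if \<omega>: "\<omega> \<in> space M" and "0 < T" for T \<omega>
  proof -
    obtain l where l: "l \<in> rgs T" "\<omega> \<in> coded_by l" using coded_by_exists[OF \<omega>] by blast
    have "0 < cluster_size y (R T \<omega>) \<longleftrightarrow> y \<in> set l" if "y \<in> set x" for y
    proof -
      have "1 \<le> y" using that assms by auto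
      then show ?thesis
        using cluster_size_coded_by[OF l(1) \<open>0 < T\<close> l(2)] count_list_0_iff[of l y]
          by (metis gr_zeroI less_not_refl)
    qed
    then have "(\<forall>y\<in>set x. 0 < cluster_size y (R T \<omega>)) \<longleftrightarrow> set x \<subseteq> set l" by blast
    then show ?thesis
      unfolding G_def sum_indicator_coded_by[OF l] by (simp only:)
  qed
  have E_G: "expectation (G T) = (\<Sum>l\<in>covering T x. word_prob (l @ x))" if "0 < T" for T
  proof -
    have "expectation (G T) = (\<Sum>l\<in>rgs T. expectation (\<lambda>\<omega>. indicator (coded_by l) \<omega> *
      (of_bool (set x \<subseteq> set l) * word_freq x \<omega>)))"
      unfolding G_def
    proof (rule Bochner_Integration.integral_sum, rule integrable_bounded)
      fix l show "AE \<omega> in M. \<bar>indicator (coded_by l) \<omega> * (of_bool (set x \<subseteq> set l) *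
        word_freq x \<omega>)\<bar> \<le> 1"
        using AE_word_freq_bounds[OF assms] by eventually_elim (simp add: indicator_def)
    qed measurable
    also have "\<dots> = (\<Sum>l\<in>rgs T. if set x \<subseteq> set l then word_prob (l @ x) else 0)"
      using expectation_coded_by_word_freq[OF _ that] by (intro sum.cong refl) auto
    also have "\<dots> = (\<Sum>l\<in>covering T x. word_prob (l @ x))"
      unfolding covering_def by (simp add: sum.inter_filter finite_rgs)
    finally show ?thesis .
  qed
  have G_bound: "AE \<omega> in M. 0 \<le> G T \<omega> \<and> G T \<omega> \<le> word_freq x \<omega> \<and> word_freq x \<omega> \<le> 1" if "0 < T" for T
    using AE_word_freq_bounds[OF assms] AE_space by eventually_elim (simp add: G_eq that)
  have int_G: "integrable M (G T)" if "0 < T" for T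
    by (rule integrable_bounded[where B = 1]) (use G_bound[OF that] in \<open>auto elim: eventually_mono\<close>)
  have int_W: "integrable M (word_freq x)"
    by (rule integrable_bounded[where B = 1]) (use AE_word_freq_bounds[OF assms]
      in \<open>auto elim: eventually_mono\<close>)
  show "(\<Sum>l\<in>covering T x. word_prob (l @ x)) \<le> mean_freq x" if "0 < T"
    unfolding E_G[OF that, symmetric] mean_freq_def
    by (rule integral_mono_AE[OF int_G[OF that] int_W]) (use G_bound[OF that]
      in \<open>auto elim: eventually_mono\<close>)
  have "(\<lambda>T. expectation (G (Suc T))) \<longlonglongrightarrow> expectation (word_freq x)"
  proof (rule integral_dominated_convergence[where w = "\<lambda>_. 1"])
    show "AE \<omega> in M. norm (G (Suc T) \<omega>) \<le> 1" for T
      using G_bound[of "Suc T"] by (auto elim: eventually_mono)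
    have "AE \<omega> in M. \<forall>y\<in>set x. (\<lambda>n. real (cluster_size y (R n \<omega>)) / real n) \<longlonglongrightarrow> P y \<omega>"
      by (rule AE_finite_allI) (use assms frequencies in \<open>auto simp: size_biased_frequencies_def\<close>)
    then show "AE \<omega> in M. (\<lambda>T. G (Suc T) \<omega>) \<longlonglongrightarrow> word_freq x \<omega>"
      using AE_P_bounds AE_space
    proof eventually_elim
      case (elim \<omega>)
      have "\<forall>y\<in>set x. \<forall>\<^sub>F n in sequentially. 0 < cluster_size y (R n \<omega>)"
      proof
        fix y assume y: "y \<in> set x"
        then have "0 < P y \<omega>" using elim assms by auto
        with y elim have "\<forall>\<^sub>F n in sequentially. 0 < real (cluster_size y (R n \<omega>)) / real n"
          by (auto dest: order_tendstoD)
        then show "\<forall>\<^sub>F n in sequentially. 0 < cluster_size y (R n \<omega>)"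
          by eventually_elim (simp add: zero_less_divide_iff)
      qed
      then have "\<forall>\<^sub>F n in sequentially. \<forall>y\<in>set x. 0 < cluster_size y (R n \<omega>)"
        by (simp add: eventually_ball_finite_distrib)
      then have "\<forall>\<^sub>F n in sequentially. \<forall>y\<in>set x. 0 < cluster_size y (R (Suc n) \<omega>)"
        by (subst eventually_sequentially_Suc)
      then have "\<forall>\<^sub>F T in sequentially. G (Suc T) \<omega> = word_freq x \<omega>"
        by eventually_elim (use elim in \<open>simp add: G_eq\<close>)
      then show ?case by (rule tendsto_eventually)
    qed
  qed simp_all
  then have "(\<lambda>T. \<Sum>l\<in>covering (Suc T) x. word_prob (l @ x)) \<longlonglongrightarrow> mean_freq x"
    by (simp add: E_G mean_freq_def)
  then show "(\<lambda>T. \<Sum>l\<in>covering T x. word_prob (l @ x)) \<longlonglongrightarrow> mean_freq x"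
    by (rule LIMSEQ_imp_Suc)
qed

lemma sum_mean_freq_tendsto: "(\<lambda>m. \<Sum>a\<in>{1..m}. mean_freq [a]) \<longlonglongrightarrow> 1"
proof -
  have wf: "word_freq [a] = P a" for a by (simp add: word_freq_def fun_eq_iff)
  have int_P: "integrable M (P a)" if "1 \<le> a" for a
    by (rule integrable_bounded[where B = 1])
      (use P_measurable[OF that] AE_P_bounds that in \<open>auto elim!: eventually_mono\<close>)
  have "(\<lambda>m. expectation (\<lambda>\<omega>. \<Sum>a\<in>{1..m}. P a \<omega>)) \<longlonglongrightarrow> expectation (\<lambda>_. 1)"
  proof (rule integral_dominated_convergence[where w = "\<lambda>_. 1"])
    show "(\<lambda>\<omega>. \<Sum>a\<in>{1..m}. P a \<omega>) \<in> borel_measurable M" for m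
      using P_measurable by (intro borel_measurable_sum) auto
    have eq: "(\<Sum>a\<in>{1..m}. P a \<omega>) = (\<Sum>a<m. P (Suc a) \<omega>)" for m \<omega>
      by (simp add: sum.atLeast1_atMost_eq)
    show "AE \<omega> in M. (\<lambda>m. \<Sum>a\<in>{1..m}. P a \<omega>) \<longlonglongrightarrow> 1"
      using proper unfolding proper_frequencies_def eq by eventually_elim (simp add: sums_def)
    show "AE \<omega> in M. norm (\<Sum>a\<in>{1..m}. P a \<omega>) \<le> 1" for m
      using proper unfolding proper_frequencies_def eq
    proof eventually_elim
      case (elim \<omega>)
      then have "(\<Sum>a<m. P (Suc a) \<omega>) \<le> (\<Sum>a. P (Suc a) \<omega>)"
        by (intro sum_le_suminf) (auto simp: sums_iff intro: less_imp_le)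
      moreover have "0 \<le> (\<Sum>a<m. P (Suc a) \<omega>)"
        using elim by (intro sum_nonneg) (auto intro: less_imp_le)
      ultimately show ?case using elim by (simp add: sums_iff)
    qed
  qed simp_all
  moreover have "expectation (\<lambda>\<omega>. \<Sum>a\<in>{1..m}. P a \<omega>) = (\<Sum>a\<in>{1..m}. mean_freq [a])" for m
    unfolding mean_freq_def wf by (rule Bochner_Integration.integral_sum) (simp add: int_P)
  ultimately show ?thesis by (simp add: prob_space)
qed

lemma sum_word_prob_rgs:
  assumes "0 < T"
  shows "(\<Sum>l\<in>rgs T. word_prob l) = 1"
proof -
  have "(\<Sum>l\<in>rgs T. word_prob l) = (\<Sum>l\<in>rgs T. expectation (indicator (coded_by l)))"
    using prob_coded_by[OF _ assms] by (intro sum.cong refl) simp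
  also have "\<dots> = expectation (\<lambda>\<omega>. \<Sum>l\<in>rgs T. indicator (coded_by l) \<omega>)"
    by (rule Bochner_Integration.integral_sum[symmetric]) (simp add: emeasure_eq_measure)
  also have "\<dots> = expectation (\<lambda>_. 1)"
  proof (rule Bochner_Integration.integral_cong[OF refl])
    fix \<omega> assume "\<omega> \<in> space M"
    then obtain l where "l \<in> rgs T" "\<omega> \<in> coded_by l" using coded_by_exists by blast
    from sum_indicator_coded_by[OF this, of "\<lambda>_. 1"]
    show "(\<Sum>l\<in>rgs T. indicator (coded_by l) \<omega>) = (1 :: real)" by simp
  qed
  finally show ?thesis by (simp add: prob_space)
qed

text \<open>
A new cluster at time \<open>T + 1\<close> has the probability that a draw misses the clusters present at
time \<open>T\<close>, and the frequencies of the clusters present eventually exhaust the total mass one.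
\<close>

lemma new_cluster_prob_tendsto_0:
  "(\<lambda>T. \<Sum>l\<in>rgs T. word_prob (l @ [Suc (card (set l))])) \<longlonglongrightarrow> 0"
proof -
  define \<tau> where "\<tau> T = (\<Sum>l\<in>rgs T. word_prob (l @ [Suc (card (set l))]))" for T
  have bound: "\<tau> T \<le> 1 - (\<Sum>a\<in>{1..m}. \<Sum>l\<in>covering T [a]. word_prob (l @ [a]))" if "0 < T" for T m
  proof -
    have ne: "l \<noteq> []" if "l \<in> rgs T" for l using length_rgs[OF that] \<open>0 < T\<close> by auto
    have new: "Suc (card (set l)) \<notin> set l" if "l \<in> rgs T" for l
      using set_rgs[OF that] by (metis atLeastAtMost_iff not_less_eq_eq order_refl)
    have "1 = (\<Sum>l\<in>rgs T. (\<Sum>a\<in>set l. word_prob (l @ [a])) + word_prob (l @ [Suc (card (set l))]))"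
      unfolding sum_word_prob_rgs[OF that, symmetric]
      by (intro sum.cong refl word_prob_consistent ne new)
    then have \<tau>: "\<tau> T = 1 - (\<Sum>l\<in>rgs T. \<Sum>a\<in>set l. word_prob (l @ [a]))"
      by (simp add: \<tau>_def sum.distrib)
    have "(\<Sum>a\<in>{1..m}. \<Sum>l\<in>covering T [a]. word_prob (l @ [a])) =
      (\<Sum>a\<in>{1..m}. \<Sum>l\<in>rgs T. if a \<in> set l then word_prob (l @ [a]) else 0)"
      by (simp add: covering_def sum.inter_filter finite_rgs)
    also have "\<dots> = (\<Sum>l\<in>rgs T. \<Sum>a\<in>{1..m}. if a \<in> set l then word_prob (l @ [a]) else 0)"
      by (rule sum.swap)
    also have "\<dots> = (\<Sum>l\<in>rgs T. \<Sum>a\<in>{1..m} \<inter> set l. word_prob (l @ [a]))"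
      by (simp add: sum.inter_restrict)
    also have "\<dots> \<le> (\<Sum>l\<in>rgs T. \<Sum>a\<in>set l. word_prob (l @ [a]))"
      by (intro sum_mono sum_mono2) (auto intro: less_imp_le[OF word_prob_pos])
    finally show ?thesis unfolding \<tau> by simp
  qed
  have nonneg: "0 \<le> \<tau> T" for T
    unfolding \<tau>_def by (intro sum_nonneg less_imp_le[OF word_prob_pos]) simp
  have "\<tau> \<longlonglongrightarrow> 0"
  proof (rule order_tendstoI)
    fix e :: real assume "0 < e"
    then have "\<forall>\<^sub>F m in sequentially. 1 - e < (\<Sum>a\<in>{1..m}. mean_freq [a])"
      by (intro order_tendstoD(1)[OF sum_mean_freq_tendsto]) simp
    then obtain m where m: "1 - e < (\<Sum>a\<in>{1..m}. mean_freq [a])"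
      using eventually_happens'[OF sequentially_bot] by blast
    have "(\<lambda>T. \<Sum>a\<in>{1..m}. \<Sum>l\<in>covering T [a]. word_prob (l @ [a])) \<longlonglongrightarrow> (\<Sum>a\<in>{1..m}. mean_freq [a])"
      by (intro tendsto_sum covering_word_prob_tendsto) auto
    then have "\<forall>\<^sub>F T in sequentially. 1 - e < (\<Sum>a\<in>{1..m}. \<Sum>l\<in>covering T [a]. word_prob (l @ [a]))"
      using m by (rule order_tendstoD)
    then show "\<forall>\<^sub>F T in sequentially. \<tau> T < e"
      using eventually_gt_at_top[of 0]
    proof eventually_elim
      case (elim T)
      then show ?case using bound[of T m] by linarith
    qed
  next
    fix e :: real assume "e < 0"
    then show "\<forall>\<^sub>F T in sequentially. e < \<tau> T"
      using nonneg by (intro always_eventually allI) (meson less_le_trans)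
  qed
  then show ?thesis unfolding \<tau>_def .
qed

definition value_lists :: "nat \<Rightarrow> nat \<Rightarrow> nat list set" where
  "value_lists k m = {j. sorted_wrt (<) j \<and> set j \<subseteq> {1..m} \<and> length j = k}"

lemma finite_value_lists: "finite (value_lists k m)"
  by (rule finite_subset[OF _ finite_lists_length_eq[of "{1..m}" k]]) (auto simp: value_lists_def)

text \<open>
Both bounds compare with the complete matchings at time \<open>T\<close>: the values \<open>j\<close> up to \<open>T\<close> majorise
the labels present at time \<open>T\<close>, while any fixed finite set of values is eventually present,
where the weight of complete matchings is at most the conserved total.
\<close>

lemma pattern_mean_freq_tendsto:
  assumes w: "set w = {0..<k}" "0 < k" and ns: "ns = map (count_list w) [0..<k]"
  shows "(\<lambda>m. \<Sum>j\<in>value_lists k m. mean_freq (map ((!) j) w)) \<longlonglongrightarrow> word_prob w * order_prob ns 0"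
proof -
  interpret gibbs_pattern \<alpha> V w k ns
    by unfold_locales (use w ns in auto)
  let ?G = "word_prob w * order_prob ns 0"
  have set_word: "set (map ((!) j) w) = set j" if "length j = k" for j
    using that by (simp add: w(1) nth_image)
  have complete: "complete_prob T = (\<Sum>j\<in>value_lists k T. \<Sum>l\<in>covering T (map ((!) j) w). word_prob
    (l @ map ((!) j) w))" for T
  proof -
    let ?S = "SIGMA j:value_lists k T. covering T (map ((!) j) w)"
    have "(\<Sum>j\<in>value_lists k T. \<Sum>l\<in>covering T (map ((!) j) w). word_prob (l @ map ((!) j) w)) =
      (\<Sum>(j, l)\<in>?S. word_prob (l @ map ((!) j) w))"
      by (rule sum.Sigma) (auto simp: finite_value_lists covering_def finite_rgs)
    also have "\<dots> = complete_prob T"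
      unfolding complete_prob_def
    proof (rule sum.reindex_bij_witness[of _ prod.swap prod.swap])
      fix s assume "s \<in> {(l, j). (l, j) \<in> matchings k T \<and> length j = k}"
      then obtain l j where s: "s = (l, j)" "l \<in> rgs T" "sorted_wrt (<) j" "set j \<subseteq> set l" "length
        j = k"
        by (auto simp: matchings_def)
      have "set l \<subseteq> {1..T}"
        using set_rgs[OF s(2)] card_length[of l] length_rgs[OF s(2)]
          by (metis atLeastatMost_subset_iff order_refl)
      then have "j \<in> value_lists k T" using s by (auto simp: value_lists_def)
      moreover have "l \<in> covering T (map ((!) j) w)"
        unfolding covering_def mem_Collect_eq set_word[OF s(5)] using s by blast
      ultimately show "prod.swap s \<in> ?S" by (simp add: s(1))
    next
      fix s assume "s \<in> ?S"
      then obtain j l where s: "s = (j, l)" "j \<in> value_lists k T" "l \<in> rgs T" "set (map ((!) j) w)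
        \<subseteq> set l"
        by (auto simp: covering_def)
      have "length j = k" using s by (simp add: value_lists_def)
      with s(4) have "set j \<subseteq> set l" unfolding set_word[OF \<open>length j = k\<close>] by simp
      then show "prod.swap s \<in> {(l, j). (l, j) \<in> matchings k T \<and> length j = k}"
        using s by (auto simp: matchings_def value_lists_def)
    qed auto
    finally show ?thesis by simp
  qed
  have pos: "set (map ((!) j) w) \<subseteq> {1..}" if "j \<in> value_lists k m" for j m
  proof -
    have "length j = k" "set j \<subseteq> {1..}" using that by (auto simp: value_lists_def)
    then show ?thesis using set_word[of j] by simp
  qed
  have upper: "(\<Sum>j\<in>value_lists k m. mean_freq (map ((!) j) w)) \<le> ?G" for m
  proof (rule LIMSEQ_le_const2)
    show "(\<lambda>T. \<Sum>j\<in>value_lists k m. \<Sum>l\<in>covering T (map ((!) j) w). word_prob (l @ map ((!) j) w))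
      \<longlonglongrightarrow> (\<Sum>j\<in>value_lists k m. mean_freq (map ((!) j) w))"
      by (intro tendsto_sum covering_word_prob_tendsto pos)
    have "(\<Sum>j\<in>value_lists k m. \<Sum>l\<in>covering T (map ((!) j) w). word_prob (l @ map ((!) j) w)) \<le>
      ?G" if "m \<le> T" for T
    proof -
      have "(\<Sum>j\<in>value_lists k m. \<Sum>l\<in>covering T (map ((!) j) w). word_prob (l @ map ((!) j) w)) \<le>
        (\<Sum>j\<in>value_lists k T. \<Sum>l\<in>covering T (map ((!) j) w). word_prob (l @ map ((!) j) w))"
        using that w by (intro sum_mono2 finite_value_lists sum_nonneg less_imp_le[OF
          word_prob_pos])
          (auto simp: value_lists_def)
      also have "\<dots> \<le> ?G" unfolding complete[symmetric] by (rule complete_prob_le)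
      finally show ?thesis .
    qed
    then show "\<exists>N. \<forall>T\<ge>N. (\<Sum>j\<in>value_lists k m. \<Sum>l\<in>covering T (map ((!) j) w). word_prob (l @ map
      ((!) j) w)) \<le> ?G"
      by blast
  qed
  have lower: "?G - real k * (\<Sum>l\<in>rgs T. word_prob (l @ [Suc (card (set l))])) \<le>
      (\<Sum>j\<in>value_lists k T. mean_freq (map ((!) j) w))" if "0 < T" for T
  proof -
    have "complete_prob T \<le> (\<Sum>j\<in>value_lists k T. mean_freq (map ((!) j) w))"
      unfolding complete by (intro sum_mono covering_word_prob_le pos that)
    then show ?thesis using complete_prob_ge[of T] by linarith
  qed
  show ?thesis
  proof (rule tendsto_sandwich)
    show "(\<lambda>T. ?G - real k * (\<Sum>l\<in>rgs T. word_prob (l @ [Suc (card (set l))]))) \<longlonglongrightarrow> ?G"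
      using tendsto_diff[OF tendsto_const tendsto_mult[OF tendsto_const
        new_cluster_prob_tendsto_0], of ?G "real k"]
      by simp
    show "\<forall>\<^sub>F T in sequentially. ?G - real k * (\<Sum>l\<in>rgs T. word_prob (l @ [Suc (card (set l))])) \<le>
      (\<Sum>j\<in>value_lists k T. mean_freq (map ((!) j) w))"
      using eventually_gt_at_top[of 0] by eventually_elim (rule lower)
    show "\<forall>\<^sub>F T in sequentially. (\<Sum>j\<in>value_lists k T. mean_freq (map ((!) j) w)) \<le> ?G"
      using upper by simp
  qed simp
qed

end

section \<open>Order patterns of words\<close>

text \<open>
Each value is replaced by its rank, counted from 0, among the values of the word.
\<close>

definition pattern :: "nat list \<Rightarrow> nat list" where
  "pattern xs = map (\<lambda>x. card {y \<in> set xs. y < x}) xs"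

lemma rank_nth:
  assumes "sorted_wrt (<) (j :: nat list)" "i < length j"
  shows "card {y \<in> set j. y < j ! i} = i"
proof -
  have less: "j ! a < j ! b" if "a < b" "b < length j" for a b
    using sorted_wrt_nth_less[OF assms(1) that] .
  have "{y \<in> set j. y < j ! i} = (!) j ` {..<i}"
  proof (intro set_eqI iffI)
    fix y assume "y \<in> {y \<in> set j. y < j ! i}"
    then obtain a where a: "a < length j" "y = j ! a" "j ! a < j ! i"
      by (auto simp: in_set_conv_nth)
    then have "a < i" using less[of i a] by (cases a i rule: linorder_cases) auto
    then show "y \<in> (!) j ` {..<i}" using a by auto
  qed (use assms(2) less in auto)
  moreover have "inj_on ((!) j) {..<i}"
    using assms strict_sorted_iff[of j] by (auto simp: inj_on_def nth_eq_iff_index_eq)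
  ultimately show ?thesis by (simp add: card_image)
qed

lemma length_pattern [simp]: "length (pattern xs) = length xs"
  by (simp add: pattern_def)

lemma set_distinct_values [simp]: "set (distinct_values xs) = set xs"
  by (simp add: distinct_values_def)

lemma length_distinct_values [simp]: "length (distinct_values xs) = card (set xs)"
  by (simp add: distinct_values_def)

lemma sorted_distinct_values: "sorted_wrt (<) (distinct_values xs)"
  by (simp add: distinct_values_def)

lemma distinct_distinct_values: "distinct (distinct_values xs)"
  by (simp add: distinct_values_def)

lemma rank_distinct_values:
  "i < card (set xs) \<Longrightarrow> card {y \<in> set xs. y < distinct_values xs ! i} = i"
  using rank_nth[OF sorted_distinct_values, of i xs] by simp

lemma nth_distinct_values_rank:
  assumes "x \<in> set xs"
  shows "card {y \<in> set xs. y < x} < card (set xs)"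
    and "distinct_values xs ! card {y \<in> set xs. y < x} = x"
proof -
  obtain i where i: "i < card (set xs)" "x = distinct_values xs ! i"
    using assms by (metis in_set_conv_nth length_distinct_values set_distinct_values)
  then show "card {y \<in> set xs. y < x} < card (set xs)"
    and "distinct_values xs ! card {y \<in> set xs. y < x} = x"
    using rank_distinct_values[OF i(1)] by simp_all
qed

lemma pattern_inverse: "map ((!) (distinct_values xs)) (pattern xs) = xs"
  by (simp add: pattern_def nth_distinct_values_rank(2) map_idI)

lemma set_pattern: "set (pattern xs) = {0..<card (set xs)}"
proof -
  have "i \<in> set (pattern xs)" if "i < card (set xs)" for i
  proof -
    have "distinct_values xs ! i \<in> set xs"
      using that by (metis length_distinct_values nth_mem set_distinct_values)
    then show ?thesis
      unfolding pattern_def set_map by (rule rev_image_eqI) (simp add: rank_distinct_values that)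
  qed
  then show ?thesis by (auto simp: pattern_def nth_distinct_values_rank(1))
qed

lemma pattern_map_nth:
  assumes "sorted_wrt (<) j" "set w = {0..<length j}"
  shows "pattern (map ((!) j) w) = w"
proof -
  have s: "set (map ((!) j) w) = set j" using assms(2) by (simp add: nth_image)
  have "pattern (map ((!) j) w) = map (\<lambda>i. card {y \<in> set j. y < j ! i}) w"
    unfolding pattern_def s by simp
  also have "\<dots> = w"
    using assms by (intro map_idI) (simp add: rank_nth)
  finally show ?thesis .
qed

lemma distinct_values_interval: "set w = {0..<k} \<Longrightarrow> distinct_values w = [0..<k]"
  by (simp add: distinct_values_def)

lemma value_ordered_freqs_interval:
  "set w = {0..<k} \<Longrightarrow> value_ordered_freqs w = map (count_list w) [0..<k]"
  by (simp add: value_ordered_freqs_def distinct_values_interval)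

lemma value_ordered_freqs_pattern: "value_ordered_freqs (pattern xs) = value_ordered_freqs xs"
proof (rule nth_equalityI)
  show "length (value_ordered_freqs (pattern xs)) = length (value_ordered_freqs xs)"
    by (simp add: value_ordered_freqs_def set_pattern)
next
  fix i assume "i < length (value_ordered_freqs (pattern xs))"
  then have i: "i < card (set xs)"
    by (simp add: value_ordered_freqs_def set_pattern)
  have inj: "inj_on ((!) (distinct_values xs)) (set (pattern xs))"
    unfolding set_pattern using distinct_distinct_values[of xs]
    by (auto simp: inj_on_def nth_eq_iff_index_eq)
  have "count_list xs (distinct_values xs ! i) =
    count_list (map ((!) (distinct_values xs)) (pattern xs)) (distinct_values xs ! i)"
    by (simp only: pattern_inverse)
  also have "\<dots> = count_list (pattern xs) i"
    by (rule count_list_inj_map[OF inj]) (simp add: set_pattern i)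
  finally show "value_ordered_freqs (pattern xs) ! i = value_ordered_freqs xs ! i"
    using i by (simp add: value_ordered_freqs_interval[OF set_pattern]) (simp add:
      value_ordered_freqs_def)
qed

text \<open>
How the ranks of the old values change when a new value of rank \<open>r\<close> is inserted.
\<close>

definition shift_from :: "nat \<Rightarrow> nat \<Rightarrow> nat" where
  "shift_from r i = (if i < r then i else Suc i)"

lemma inj_shift_from: "inj (shift_from r)"
  by (auto simp: inj_def shift_from_def split: if_splits)

lemma shift_from_image: "r \<notin> shift_from r ` A"
  by (auto simp: shift_from_def split: if_splits)

lemma pattern_snoc_old:
  "x \<in> set xs \<Longrightarrow> pattern (xs @ [x]) = pattern xs @ [card {y \<in> set xs. y < x}]"
  by (simp add: pattern_def insert_absorb)

lemma pattern_snoc_new: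
  assumes "x \<notin> set xs"
  defines "r \<equiv> card {y \<in> set xs. y < x}"
  shows "pattern (xs @ [x]) = map (shift_from r) (pattern xs) @ [r]"
proof -
  have "card {z \<in> insert x (set xs). z < y} = shift_from r (card {z \<in> set xs. z < y})"
    if y: "y \<in> set xs" for y
  proof (cases "x < y")
    case True
    then have "{z \<in> insert x (set xs). z < y} = insert x {z \<in> set xs. z < y}" by auto
    then have "card {z \<in> insert x (set xs). z < y} = Suc (card {z \<in> set xs. z < y})"
      using assms(1) by simp
    moreover have "r \<le> card {z \<in> set xs. z < y}"
      unfolding r_def using True by (intro card_mono) auto
    ultimately show ?thesis by (simp add: shift_from_def)
  next
    case False
    then have yx: "y < x" using y assms(1) by (metis linorder_neqE_nat)
    then have "{z \<in> insert x (set xs). z < y} = {z \<in> set xs. z < y}" by auto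
    moreover have "card {z \<in> set xs. z < y} < r"
      unfolding r_def using yx y by (intro psubset_card_mono) auto
    ultimately show ?thesis by (simp add: shift_from_def)
  qed
  moreover have "{z \<in> insert x (set xs). z < x} = {z \<in> set xs. z < x}" by auto
  ultimately show ?thesis by (simp add: pattern_def r_def)
qed

lemma new_rank_iff_pattern:
  assumes "set w = {0..<k}" "r \<le> k"
  shows "pattern xs = w \<and> x \<notin> set xs \<and> x = distinct_values (xs @ [x]) ! r \<longleftrightarrow>
    pattern (xs @ [x]) = map (shift_from r) w @ [r]"
proof
  assume *: "pattern xs = w \<and> x \<notin> set xs \<and> x = distinct_values (xs @ [x]) ! r"
  then have "card (set xs) = k"
    using assms(1) set_pattern[of xs] by (metis card_atLeastLessThan diff_zero)
  then have "r < card (set (xs @ [x]))" using assms(2) * by simp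
  from rank_distinct_values[OF this] * have "card {y \<in> set (xs @ [x]). y < x} = r" by simp
  moreover have "{y \<in> set (xs @ [x]). y < x} = {y \<in> set xs. y < x}" by auto
  ultimately show "pattern (xs @ [x]) = map (shift_from r) w @ [r]"
    using pattern_snoc_new[of x xs] * by simp
next
  assume *: "pattern (xs @ [x]) = map (shift_from r) w @ [r]"
  have "x \<notin> set xs"
  proof
    assume "x \<in> set xs"
    then have "pattern xs = map (shift_from r) w" "card {y \<in> set xs. y < x} = r"
      using pattern_snoc_old[of x xs] * by auto
    moreover have "card {y \<in> set xs. y < x} \<in> set (pattern xs)"
      using \<open>x \<in> set xs\<close> by (simp add: pattern_def)
    ultimately show False using shift_from_image[of r] by (metis list.set_map)
  qed
  moreover from this have "pattern xs = w"
    using pattern_snoc_new[of x xs] * inj_map_eq_map[OF inj_shift_from] by auto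
  moreover have "x = distinct_values (xs @ [x]) ! r"
    using pattern_inverse[of "xs @ [x]"] unfolding * by simp
  ultimately show "pattern xs = w \<and> x \<notin> set xs \<and> x = distinct_values (xs @ [x]) ! r" by blast
qed

lemma old_rank_iff_pattern:
  assumes "set w = {0..<k}" "r < k"
  shows "pattern xs = w \<and> x = distinct_values xs ! r \<longleftrightarrow> pattern (xs @ [x]) = w @ [r]"
proof
  assume *: "pattern xs = w \<and> x = distinct_values xs ! r"
  then have r: "r < card (set xs)" using assms set_pattern[of xs] by auto
  then have "x \<in> set xs" using * by (metis length_distinct_values nth_mem set_distinct_values)
  then show "pattern (xs @ [x]) = w @ [r]"
    using pattern_snoc_old[of x xs] rank_distinct_values[OF r] * by simp
next
  assume *: "pattern (xs @ [x]) = w @ [r]"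
  have "x \<in> set xs"
  proof (rule ccontr)
    assume "x \<notin> set xs"
    from pattern_snoc_new[OF this] *
    have "w = map (shift_from (card {y \<in> set xs. y < x})) (pattern xs)" by simp
    moreover have "r = card {y \<in> set xs. y < x}" using pattern_snoc_new[OF \<open>x \<notin> set xs\<close>] * by simp
    moreover have "r \<in> set w" using assms by simp
    ultimately show False using shift_from_image by (metis list.set_map)
  qed
  then show "pattern xs = w \<and> x = distinct_values xs ! r"
    using pattern_snoc_old[of x xs] * nth_distinct_values_rank(2)[of x xs] by simp
qed

lemma map_count_list_insert:
  assumes "set w = {0..<k}" "r \<le> k"
  shows "set (map (shift_from r) w @ [r]) = {0..<Suc k}"
    and "map (count_list (map (shift_from r) w @ [r])) [0..<Suc k] =
      take r (map (count_list w) [0..<k]) @ 1 # drop r (map (count_list w) [0..<k])"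
proof -
  have "shift_from r ` {0..<k} = {0..<Suc k} - {r}"
  proof (intro set_eqI iffI)
    fix i assume "i \<in> {0..<Suc k} - {r}"
    then show "i \<in> shift_from r ` {0..<k}"
      using assms(2) by (intro image_eqI[of _ _ "if i < r then i else i - 1"]) (auto simp:
        shift_from_def)
  qed (auto simp: shift_from_def split: if_splits)
  then show "set (map (shift_from r) w @ [r]) = {0..<Suc k}" using assms by auto
  have cnt: "count_list (map (shift_from r) w) (shift_from r i) = count_list w i" for i
    by (rule count_list_map_conv[OF inj_shift_from])
  have cnt_r: "count_list (map (shift_from r) w) r = 0"
    using shift_from_image by (subst count_list_0_iff) simp
  show "map (count_list (map (shift_from r) w @ [r])) [0..<Suc k] =
      take r (map (count_list w) [0..<k]) @ 1 # drop r (map (count_list w) [0..<k])"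
  proof (rule nth_equalityI)
    fix i assume i: "i < length (map (count_list (map (shift_from r) w @ [r])) [0..<Suc k])"
    consider "i < r" | "i = r" | i' where "i = Suc i'" "r \<le> i'"
      by (metis Suc_pred less_Suc_eq_le linorder_neqE_nat not_less0 zero_less_iff_neq_zero)
    then show "map (count_list (map (shift_from r) w @ [r])) [0..<Suc k] ! i =
      (take r (map (count_list w) [0..<k]) @ 1 # drop r (map (count_list w) [0..<k])) ! i"
    proof cases
      case 1
      then show ?thesis using cnt[of i] assms(2) i
        by (simp add: shift_from_def nth_append del: upt_Suc)
    next
      case 2
      then show ?thesis using cnt_r assms(2) i by (simp add: nth_append del: upt_Suc)
    next
      case 3
      then show ?thesis using cnt[of i'] assms(2) i
        by (simp add: shift_from_def nth_append Suc_diff_le del: upt_Suc)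
    qed
  qed (use assms(2) in simp)
qed

lemma map_count_list_increment:
  assumes "set w = {0..<k}" "r < k" "ns = map (count_list w) [0..<k]"
  shows "set (w @ [r]) = {0..<k}"
    and "map (count_list (w @ [r])) [0..<k] = ns[r := ns ! r + 1]"
proof -
  have "r \<in> set w" using assms(1,2) by simp
  then show "set (w @ [r]) = {0..<k}" unfolding assms(1)[symmetric] by auto
  show "map (count_list (w @ [r])) [0..<k] = ns[r := ns ! r + 1]"
  proof (rule nth_equalityI)
    fix i assume "i < length (map (count_list (w @ [r])) [0..<k])"
    then have "i < k" by simp
    then show "map (count_list (w @ [r])) [0..<k] ! i = ns[r := ns ! r + 1] ! i"
      unfolding assms(3) using assms(2) by (cases "i = r") simp_all
  qed (simp add: assms(3))
qed

lemma count_list_replicate: "count_list (replicate m x) y = (if x = y then m else 0)"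
  by (induction m) auto

lemma exists_pattern_with_freqs:
  assumes "\<forall>m\<in>set ns. (1::nat) \<le> m"
  shows "\<exists>w. set w = {0..<length ns} \<and> map (count_list w) [0..<length ns] = ns"
  using assms
proof (induction ns rule: rev_induct)
  case (snoc m ns)
  then obtain w where w: "set w = {0..<length ns}" "map (count_list w) [0..<length ns] = ns" by auto
  let ?w = "w @ replicate m (length ns)"
  have "set ?w = {0..<length (ns @ [m])}" using w(1) snoc.prems by auto
  moreover have "map (count_list ?w) [0..<length ns] = map (count_list w) [0..<length ns]"
    by (intro map_cong refl) (auto simp: count_list_replicate)
  moreover have "count_list ?w (length ns) = m" using w(1) by (simp add: count_list_replicate)
  moreover have "[0..<length (ns @ [m])] = [0..<length ns] @ [length ns]" by simp
  ultimately show ?case using w(2)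
    by (intro exI[of _ ?w]) (simp only: map_append list.map simp_thms)
qed simp

section \<open>Insertion and increment identities for the law of the value-ordered frequencies\<close>

context gibbs begin

lemma order_prob_Cons: "order_prob (m # ms) 0 = h \<alpha> (m # ms) * order_prob ms 0"
  by (simp add: order_prob_def prod.atLeast0_lessThan_Suc_shift del: prod.op_ivl_Suc)

text \<open>
Inserting a singleton adds \<open>1 - \<alpha>\<close> to the denominators of the factors in front of it, and \<open>S /
(S + (1 - \<alpha>))\<close> is the complement of the singleton's own share.
\<close>

lemma order_prob_insert:
  assumes "\<forall>m\<in>set ns. 1 \<le> m" "r \<le> length ns"
  shows "order_prob (take r ns @ 1 # drop r ns) 0 =
    order_prob ns 0 * h \<alpha> (1 # drop r ns) * (\<Prod>i<r. 1 - h \<alpha> (1 # drop i ns))"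
  using assms
proof (induction ns arbitrary: r)
  case Nil
  then show ?case by (simp add: order_prob_Cons)
next
  case (Cons m ms)
  show ?case
  proof (cases r)
    case 0
    then show ?thesis by (simp add: order_prob_Cons)
  next
    case (Suc r')
    define S where "S = (\<Sum>m\<leftarrow>m # ms. real m - \<alpha>)"
    have S: "0 < S" unfolding S_def using Cons.prems by (intro h_bounds(3)) auto
    have S': "0 < S + (1 - \<alpha>)" using S alpha_less_1 by simp
    have sum_ins: "(\<Sum>m\<leftarrow>take r' ms @ 1 # drop r' ms. real m - \<alpha>) = (\<Sum>m\<leftarrow>ms. real m - \<alpha>) + (1 - \<alpha>)"
    proof -
      have "(\<Sum>m\<leftarrow>ms. real m - \<alpha>) = (\<Sum>m\<leftarrow>take r' ms. real m - \<alpha>) + (\<Sum>m\<leftarrow>drop r' ms. real m - \<alpha>)"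
        by (metis append_take_drop_id map_append sum_list_append)
      then show ?thesis by simp
    qed
    have "h \<alpha> (m # take r' ms @ 1 # drop r' ms) = h \<alpha> (m # ms) * (1 - h \<alpha> (1 # m # ms))"
    proof -
      have "h \<alpha> (m # take r' ms @ 1 # drop r' ms) = (real m - \<alpha>) / (S + (1 - \<alpha>))"
        unfolding h_def S_def using sum_ins by (simp add: algebra_simps)
      moreover have "h \<alpha> (m # ms) = (real m - \<alpha>) / S" by (simp add: h_def S_def)
      moreover have "h \<alpha> (1 # m # ms) = (1 - \<alpha>) / (S + (1 - \<alpha>))"
        by (simp add: h_def S_def add.commute)
      moreover have "1 - (1 - \<alpha>) / (S + (1 - \<alpha>)) = S / (S + (1 - \<alpha>))"
        using S' by (simp add: diff_divide_eq_iff)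
      ultimately show ?thesis using S by simp
    qed
    then show ?thesis
      using Cons.IH[of r'] Cons.prems Suc
      by (simp add: order_prob_Cons prod.lessThan_Suc_shift mult_ac del: prod.lessThan_Suc)
  qed
qed

text \<open>
With \<open>S i\<close> the sum of the weights from position \<open>i\<close> on, the factors in front of \<open>r\<close> change by \<open>S
i / (S i + 1)\<close>, whereas the stick-breaking factors are \<open>S (Suc i) / (S i + 1)\<close>. The product of
their quotients telescopes to \<open>S 0 / S r\<close>, and the factor \<open>S r\<close> lost at position \<open>r\<close> turns this
into the full sum of the weights.
\<close>

lemma order_prob_increment:
  assumes "\<forall>m\<in>set ns. 1 \<le> m" "r < length ns"
  shows "(real (ns ! r) - \<alpha>) * order_prob (ns[r := ns ! r + 1]) 0 =
    order_prob ns 0 * (\<Sum>m\<leftarrow>ns. real m - \<alpha>) * h \<alpha> ((ns ! r + 1) # drop (Suc r) ns) *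
    (\<Prod>i<r. 1 - h \<alpha> ((ns ! i + 1) # drop (Suc i) ns))"
  using assms
proof (induction ns arbitrary: r)
  case (Cons m ms)
  define S where "S = (\<Sum>m\<leftarrow>m # ms. real m - \<alpha>)"
  have S: "0 < S" unfolding S_def using Cons.prems by (intro h_bounds(3)) auto
  have hm: "h \<alpha> (m # ms) = (real m - \<alpha>) / S" by (simp add: h_def S_def)
  have hm1: "h \<alpha> ((m + 1) # ms) = (real m + 1 - \<alpha>) / (S + 1)"
    by (simp add: h_def S_def algebra_simps)
  have S_eq: "S = real m - \<alpha> + (\<Sum>m\<leftarrow>ms. real m - \<alpha>)" by (simp add: S_def)
  show ?case
  proof (cases r)
    case 0
    then show ?thesis
      using S unfolding S_def[symmetric] by (simp add: order_prob_Cons hm hm1[simplified])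
  next
    case (Suc r')
    let ?ms' = "ms[r' := ms ! r' + 1]"
    have r': "r' < length ms" using Cons.prems Suc by simp
    have "(\<Sum>m\<leftarrow>?ms'. real m - \<alpha>) = (\<Sum>m\<leftarrow>ms. real m - \<alpha>) + 1"
    proof -
      have "(\<Sum>m\<leftarrow>ms. real m - \<alpha>) = (\<Sum>m\<leftarrow>take r' ms @ ms ! r' # drop (Suc r') ms. real m - \<alpha>)"
        using id_take_nth_drop[OF r'] by simp
      then show ?thesis unfolding upd_conv_take_nth_drop[OF r'] by simp
    qed
    then have "h \<alpha> (m # ?ms') = (real m - \<alpha>) / (S + 1)"
      by (simp add: h_def S_eq algebra_simps)
    then have "(real (ms ! r') - \<alpha>) * order_prob (m # ?ms') 0 =
      (real m - \<alpha>) / (S + 1) * ((real (ms ! r') - \<alpha>) * order_prob ?ms' 0)"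
      by (simp add: order_prob_Cons)
    also have "\<dots> = (real m - \<alpha>) / (S + 1) * (order_prob ms 0 * (\<Sum>m\<leftarrow>ms. real m - \<alpha>) *
      h \<alpha> ((ms ! r' + 1) # drop (Suc r') ms) * (\<Prod>i<r'. 1 - h \<alpha> ((ms ! i + 1) # drop (Suc i) ms)))"
      using Cons.IH[of r'] Cons.prems r' by simp
    also have "\<dots> = (order_prob ms 0 * h \<alpha> ((ms ! r' + 1) # drop (Suc r') ms) *
      (\<Prod>i<r'. 1 - h \<alpha> ((ms ! i + 1) # drop (Suc i) ms))) *
      ((real m - \<alpha>) / (S + 1) * (\<Sum>m\<leftarrow>ms. real m - \<alpha>))"
      by (simp only: mult_ac)
    also have "(real m - \<alpha>) / (S + 1) * (\<Sum>m\<leftarrow>ms. real m - \<alpha>) =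
      h \<alpha> (m # ms) * S * (1 - h \<alpha> ((m + 1) # ms))"
    proof -
      have "1 - (real m + 1 - \<alpha>) / (S + 1) = (\<Sum>m\<leftarrow>ms. real m - \<alpha>) / (S + 1)"
        using S S_eq by (simp add: field_simps)
      then show ?thesis unfolding hm hm1 using S by simp
    qed
    finally show ?thesis
      using Suc unfolding S_def[symmetric]
      by (simp add: order_prob_Cons prod.lessThan_Suc_shift mult_ac del: prod.lessThan_Suc)
  qed
qed simp

text \<open>
The probability that a sample has a given order pattern with frequencies \<open>ns\<close>. It is the product
of the EPPF and of the probability that the clusters, in size-biased order with weights \<open>m - \<alpha>\<close>,
appear as listed.
\<close>

definition freqs_prob :: "nat list \<Rightarrow> real" where
  "freqs_prob ns = V (length ns) (sum_list ns) *
     (\<Prod>m\<leftarrow>ns. pochhammer (1 - \<alpha>) (m - 1)) * order_prob ns 0"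

lemma freqs_prob_eq_word_prob:
  assumes "set w = {0..<k}" "ns = map (count_list w) [0..<k]"
  shows "freqs_prob ns = word_prob w * order_prob ns 0"
proof -
  have "sum_list ns = length w"
    using sum_count_set[of w "set w"] by (simp add: assms sum_list_distinct_conv_sum_set)
  moreover have "(\<Prod>m\<leftarrow>ns. pochhammer (1 - \<alpha>) (m - 1)) =
      (\<Prod>a\<in>set w. pochhammer (1 - \<alpha>) (count_list w a - 1))"
    by (simp add: assms prod.distinct_set_conv_list[symmetric] o_def)
  ultimately show ?thesis by (simp add: freqs_prob_def word_prob_def assms)
qed

lemma freqs_prob_pos:
  assumes "ns \<in> compositions"
  shows "0 < freqs_prob ns"
proof -
  obtain w where w: "set w = {0..<length ns}" "map (count_list w) [0..<length ns] = ns"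
    using exists_pattern_with_freqs[of ns] assms by (auto simp: compositions_def)
  then have "w \<noteq> []" using assms by (auto simp: compositions_def)
  then show ?thesis
    using freqs_prob_eq_word_prob[OF w(1) w(2)[symmetric]] word_prob_pos[of w]
      order_prob_bounds(1)[of ns 0] assms by (simp add: compositions_def)
qed

lemma freqs_prob_insert:
  assumes "ns \<in> compositions" "r \<le> length ns"
  shows "freqs_prob (take r ns @ 1 # drop r ns) = freqs_prob ns *
    (p_new V (length ns) (sum_list ns) * h \<alpha> (1 # drop r ns) * (\<Prod>i<r. 1 - h \<alpha> (1 # drop i ns)))"
proof -
  have ns: "\<forall>m\<in>set ns. 1 \<le> m" "ns \<noteq> []" using assms(1) by (auto simp: compositions_def)
  have "sum_list (take r ns) + sum_list (drop r ns) = sum_list ns"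
    by (metis append_take_drop_id sum_list_append)
  then have sum: "sum_list (take r ns @ 1 # drop r ns) = sum_list ns + 1" by simp
  have len: "length (take r ns @ 1 # drop r ns) = length ns + 1" using assms(2) by simp
  have "(\<Prod>m\<leftarrow>take r ns. pochhammer (1 - \<alpha>) (m - 1)) * (\<Prod>m\<leftarrow>drop r ns. pochhammer (1 - \<alpha>) (m - 1)) =
    (\<Prod>m\<leftarrow>ns. pochhammer (1 - \<alpha>) (m - 1))"
    by (metis append_take_drop_id map_append prod_list.append)
  then have prod: "(\<Prod>m\<leftarrow>take r ns @ 1 # drop r ns. pochhammer (1 - \<alpha>) (m - 1)) =
    (\<Prod>m\<leftarrow>ns. pochhammer (1 - \<alpha>) (m - 1))" by simp
  have "V (length ns) (sum_list ns) > 0"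
  proof (rule V_pos)
    show "length ns \<le> sum_list ns"
      using ns(1) by (induction ns) auto
  qed (use ns(2) in \<open>cases ns; simp\<close>)
  then show ?thesis
    unfolding freqs_prob_def sum len prod order_prob_insert[OF ns(1) assms(2)] p_new_def
    by simp
qed

lemma freqs_prob_increment:
  assumes "ns \<in> compositions" "r < length ns"
  shows "freqs_prob (ns[r := ns ! r + 1]) = freqs_prob ns *
    ((1 - p_new V (length ns) (sum_list ns)) * h \<alpha> ((ns ! r + 1) # drop (Suc r) ns) *
     (\<Prod>i<r. 1 - h \<alpha> ((ns ! i + 1) # drop (Suc i) ns)))"
proof -
  let ?k = "length ns" and ?n = "sum_list ns"
  let ?ns' = "ns[r := ns ! r + 1]"
  have ns: "\<forall>m\<in>set ns. 1 \<le> m" "ns \<noteq> []" using assms(1) by (auto simp: compositions_def)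
  have split: "ns = take r ns @ ns ! r # drop (Suc r) ns" by (rule id_take_nth_drop[OF assms(2)])
  have split': "?ns' = take r ns @ (ns ! r + 1) # drop (Suc r) ns"
    by (rule upd_conv_take_nth_drop[OF assms(2)])
  have "sum_list ns = sum_list (take r ns @ ns ! r # drop (Suc r) ns)" using split by simp
  then have sum: "sum_list ?ns' = ?n + 1" unfolding split' by simp
  obtain m where m: "ns ! r = Suc m" using ns(1) nth_mem[OF assms(2)] by (cases "ns ! r") auto
  have "(\<Prod>m\<leftarrow>ns. pochhammer (1 - \<alpha>) (m - 1)) =
    (\<Prod>m\<leftarrow>take r ns @ ns ! r # drop (Suc r) ns. pochhammer (1 - \<alpha>) (m - 1))" using split by simp
  then have prod: "(\<Prod>m\<leftarrow>?ns'. pochhammer (1 - \<alpha>) (m - 1)) =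
    (\<Prod>m\<leftarrow>ns. pochhammer (1 - \<alpha>) (m - 1)) * (real (ns ! r) - \<alpha>)"
    unfolding split' by (simp add: m pochhammer_Suc algebra_simps)
  have k: "1 \<le> ?k" using ns(2) by (cases ns) auto
  have kn: "?k \<le> ?n" using ns(1) by (induction ns) auto
  have Vpos: "V ?k ?n > 0" by (rule V_pos[OF k kn])
  have "(\<Sum>m\<leftarrow>ns. real m - \<alpha>) = real ?n - real ?k * \<alpha>"
    by (induction ns) (auto simp: algebra_simps)
  then have Vrec: "V ?k (?n + 1) * (\<Sum>m\<leftarrow>ns. real m - \<alpha>) = V ?k ?n * (1 - p_new V ?k ?n)"
  proof -
    have "V ?k ?n * (1 - p_new V ?k ?n) = V ?k ?n - V (Suc ?k) (Suc ?n)"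
      using Vpos by (simp add: p_new_def right_diff_distrib)
    then show ?thesis using V_rec[OF k kn] \<open>(\<Sum>m\<leftarrow>ns. real m - \<alpha>) = _\<close> by simp
  qed
  have "freqs_prob ?ns' = V ?k (?n + 1) * (\<Prod>m\<leftarrow>ns. pochhammer (1 - \<alpha>) (m - 1)) *
    ((real (ns ! r) - \<alpha>) * order_prob ?ns' 0)"
    unfolding freqs_prob_def sum prod by simp
  also have "\<dots> = (V ?k (?n + 1) * (\<Sum>m\<leftarrow>ns. real m - \<alpha>)) * (\<Prod>m\<leftarrow>ns. pochhammer (1 - \<alpha>) (m - 1)) *
    order_prob ns 0 * h \<alpha> ((ns ! r + 1) # drop (Suc r) ns) *
    (\<Prod>i<r. 1 - h \<alpha> ((ns ! i + 1) # drop (Suc i) ns))"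
    unfolding order_prob_increment[OF ns(1) assms(2)] by (simp only: mult_ac)
  finally show ?thesis unfolding Vrec freqs_prob_def by (simp only: mult_ac)
qed

end

section \<open>The law of the sample\<close>

locale gibbs_sample = gibbs_frequencies +
  fixes X :: "nat \<Rightarrow> 'a \<Rightarrow> nat"
  assumes sample: "random_sample_from M P X"
begin

lemma X_measurable_pos: "1 \<le> i \<Longrightarrow> X i \<in> measurable M (count_space {1..})"
  using sample unfolding random_sample_from_def by blast

lemma X_measurable: "1 \<le> i \<Longrightarrow> X i \<in> measurable M (count_space UNIV)"
  by (rule measurable_compose[OF X_measurable_pos]) simp_all

lemma X_pos: "1 \<le> i \<Longrightarrow> \<omega> \<in> space M \<Longrightarrow> 1 \<le> X i \<omega>"
  using measurable_space[OF X_measurable_pos] by simp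

lemma sample_Suc: "sample X (Suc n) \<omega> = sample X n \<omega> @ [X (Suc n) \<omega>]"
  by (simp add: sample_def)

lemma length_sample: "length (sample X n \<omega>) = n"
  by (simp add: sample_def)

lemma sample_pos: "\<omega> \<in> space M \<Longrightarrow> set (sample X n \<omega>) \<subseteq> {1..}"
  using X_pos by (auto simp: sample_def)

lemma sample_measurable [measurable]: "sample X n \<in> measurable M (count_space UNIV)"
proof (induction n)
  case 0
  then show ?case by (simp add: sample_def[abs_def])
next
  case (Suc n)
  note [measurable] = Suc
  have "(\<lambda>\<omega>. sample X n \<omega> @ [X (Suc n) \<omega>]) \<in> measurable M (count_space UNIV)"
    by (rule measurable_compose_countable[where g = "sample X n"])
      (auto intro: measurable_compose[OF X_measurable])
  then show ?case by (simp add: sample_Suc[abs_def])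
qed

lemma sample_event [measurable]: "{\<omega> \<in> space M. Q (sample X n \<omega>)} \<in> sets M"
  by measurable

lemma subalgebra_sigma_generated: "subalgebra M (sigma_generated M P)"
proof -
  have m: "(\<lambda>\<omega>. \<lambda>j\<in>{1..}. P j \<omega>) \<in> measurable M (\<Pi>\<^sub>M j\<in>{1..}. borel)"
    by (rule measurable_restrict) (use P_measurable in auto)
  have "{(\<lambda>\<omega>. \<lambda>j\<in>{1..}. P j \<omega>) -` A \<inter> space M |A. A \<in> sets (\<Pi>\<^sub>M j\<in>{1..}. borel)} \<subseteq> sets M"
    using measurable_sets[OF m] by blast
  from sets.sigma_sets_subset[OF this] show ?thesis
    by (simp add: subalgebra_def sigma_generated_def sets_vimage_algebra)
qed

lemma prob_sample:
  assumes "set xs \<subseteq> {1..}" "length xs = n"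
  shows "prob {\<omega> \<in> space M. sample X n \<omega> = xs} = mean_freq xs"
proof -
  let ?F = "sigma_generated M P"
  interpret finite_measure_subalgebra M ?F
    by unfold_locales (rule subalgebra_sigma_generated)
  define A where "A i = {xs ! (i - 1)}" for i
  define E where "E = {\<omega> \<in> space M. \<forall>i\<in>{1..n}. X i \<omega> \<in> A i}"
  have "sample X n \<omega> = xs \<longleftrightarrow> (\<forall>i\<in>{1..n}. X i \<omega> \<in> A i)" for \<omega>
  proof -
    have "sample X n \<omega> = xs \<longleftrightarrow> (\<forall>i<n. X (Suc i) \<omega> = xs ! i)"
      using assms(2) by (auto simp: list_eq_iff_nth_eq length_sample) (simp_all add: sample_def
        del: upt_Suc)
    also have "\<dots> \<longleftrightarrow> (\<forall>i\<in>{1..n}. X i \<omega> \<in> A i)"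
      unfolding A_def by (auto simp: Suc_le_eq) (metis Suc_pred less_eq_Suc_le less_imp_Suc_add)
    finally show ?thesis .
  qed
  then have E_eq: "{\<omega> \<in> space M. sample X n \<omega> = xs} = E" by (simp add: E_def)
  have E_sets: "E \<in> sets M" using sample_event[of "\<lambda>ys. ys = xs" n] unfolding E_eq .
  have A_pos: "1 \<le> xs ! (i - 1)" if "i \<in> {1..n}" for i
  proof -
    have "xs ! (i - 1) \<in> set xs" using assms(2) that by (intro nth_mem) auto
    then show ?thesis using assms(1) by auto
  qed
  have "AE \<omega> in M. cond_prob_given M ?F E \<omega> =
      (\<Prod>i\<in>{1..n}. cond_prob_given M ?F {\<omega>\<in>space M. X i \<omega> \<in> A i} \<omega>)"
  proof -
    have "finite {1..n}" "{1..n} \<subseteq> {1..}" by auto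
    then show ?thesis using sample unfolding random_sample_from_def E_def by blast
  qed
  moreover have "AE \<omega> in M. \<forall>i\<in>{1..n}. cond_prob_given M ?F {\<omega>\<in>space M. X i \<omega> \<in> A i} \<omega> =
    P (xs ! (i - 1)) \<omega>"
  proof (rule AE_finite_allI)
    fix i assume i: "i \<in> {1..n}"
    then show "AE \<omega> in M. cond_prob_given M ?F {\<omega>\<in>space M. X i \<omega> \<in> A i} \<omega> = P (xs ! (i - 1)) \<omega>"
      using sample A_pos[OF i] unfolding random_sample_from_def A_def by simp
  qed simp
  \<comment> \<open>Conditional independence turns the conditional probability of the word into a product of
    frequencies.\<close>
  ultimately have AE: "AE \<omega> in M. real_cond_exp M ?F (indicator E) \<omega> = word_freq xs \<omega>"
  proof eventually_elim
    case (elim \<omega>)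
    have "word_freq xs \<omega> = (\<Prod>i<n. P (xs ! i) \<omega>)"
      using assms(2) by (simp add: word_freq_def prod.list_conv_set_nth atLeast0LessThan)
    also have "\<dots> = (\<Prod>i\<in>{1..n}. P (xs ! (i - 1)) \<omega>)"
      by (simp add: prod.atLeast1_atMost_eq)
    finally show ?case using elim unfolding cond_prob_given_def by simp
  qed
  have "prob E = expectation (indicator E)"
    using sets.sets_into_space[OF E_sets] by (simp add: Int_absorb2)
  also have "\<dots> = expectation (real_cond_exp M ?F (indicator E))"
    by (rule real_cond_exp_int(2)[symmetric]) (use E_sets in \<open>simp add: emeasure_eq_measure\<close>)
  also have "\<dots> = mean_freq xs"
    unfolding mean_freq_def using AE word_freq_measurable[OF assms(1)]
    by (intro integral_cong_AE) auto
  finally show ?thesis unfolding E_eq .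
qed

text \<open>
The words with pattern \<open>w\<close> are obtained from \<open>w\<close> by choosing an increasing list of values;
exhausting the values by \<open>{1..m}\<close> gives the limit computed for the frequencies.
\<close>

lemma prob_pattern_sample:
  assumes "set w = {0..<k}" "0 < k" "length w = n"
  shows "prob {\<omega> \<in> space M. pattern (sample X n \<omega>) = w} = freqs_prob (map (count_list w) [0..<k])"
proof -
  define A where "A m = (\<Union>j\<in>value_lists k m. {\<omega> \<in> space M. sample X n \<omega> = map ((!) j) w})" for m
  have prob_A: "prob (A m) = (\<Sum>j\<in>value_lists k m. mean_freq (map ((!) j) w))" for m
  proof -
    have "prob (A m) = (\<Sum>j\<in>value_lists k m. prob {\<omega> \<in> space M. sample X n \<omega> = map ((!) j) w})"
      unfolding A_def
    proof (rule finite_measure_finite_Union[OF finite_value_lists])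
      have "j = j'" if j: "j \<in> value_lists k m" "j' \<in> value_lists k m" and eq: "map ((!) j) w =
        map ((!) j') w" for j j'
      proof (rule nth_equalityI)
        show "length j = length j'" using j by (simp add: value_lists_def)
        fix i assume "i < length j"
        then have "i \<in> set w" using j assms(1) by (simp add: value_lists_def)
        then show "j ! i = j' ! i" using eq unfolding map_eq_conv by blast
      qed
      then show "disjoint_family_on (\<lambda>j. {\<omega> \<in> space M. sample X n \<omega> =
        map ((!) j) w}) (value_lists k m)"
        unfolding disjoint_family_on_def by fastforce
    qed auto
    also have "\<dots> = (\<Sum>j\<in>value_lists k m. mean_freq (map ((!) j) w))"
    proof (intro sum.cong refl prob_sample)
      fix j assume "j \<in> value_lists k m"
      then have "length j = k" "set j \<subseteq> {1..}" by (auto simp: value_lists_def)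
      then show "set (map ((!) j) w) \<subseteq> {1..}" using assms(1) by (simp add: nth_image)
    qed (simp add: assms(3))
    finally show ?thesis .
  qed
  have "(\<Union>m. A m) = {\<omega> \<in> space M. pattern (sample X n \<omega>) = w}"
  proof (intro set_eqI iffI)
    fix \<omega> assume "\<omega> \<in> (\<Union>m. A m)"
    then show "\<omega> \<in> {\<omega> \<in> space M. pattern (sample X n \<omega>) = w}"
      using pattern_map_nth assms(1) by (auto simp: A_def value_lists_def)
  next
    fix \<omega> assume "\<omega> \<in> {\<omega> \<in> space M. pattern (sample X n \<omega>) = w}"
    then have \<omega>: "\<omega> \<in> space M" and w: "pattern (sample X n \<omega>) = w" by auto
    let ?j = "distinct_values (sample X n \<omega>)"
    obtain m where "set (sample X n \<omega>) \<subseteq> {..m}"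
      using finite_nat_iff_bounded_le[of "set (sample X n \<omega>)"] by auto
    then have "set ?j \<subseteq> {1..m}" using sample_pos[OF \<omega>, of n] by auto
    moreover have "length ?j = k"
      using set_pattern[of "sample X n \<omega>"] w assms(1)
        by (metis card_atLeastLessThan diff_zero length_distinct_values)
    ultimately have "?j \<in> value_lists k m" by (simp add: value_lists_def sorted_distinct_values)
    moreover have "sample X n \<omega> = map ((!) ?j) w"
      using pattern_inverse[of "sample X n \<omega>"] w by simp
    ultimately show "\<omega> \<in> (\<Union>m. A m)" using \<omega> by (auto simp: A_def)
  qed
  moreover have "(\<lambda>m. prob (A m)) \<longlonglongrightarrow> prob (\<Union>m. A m)"
  proof (rule finite_Lim_measure_incseq)
    show "range A \<subseteq> sets M"
      unfolding A_def by (auto intro!: sets.finite_UN finite_value_lists)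
    have "value_lists k m \<subseteq> value_lists k (Suc m)" for m by (auto simp: value_lists_def)
    then show "incseq A"
      unfolding A_def by (intro incseq_SucI UN_mono order_refl)
  qed
  ultimately show ?thesis
    using LIMSEQ_unique[OF pattern_mean_freq_tendsto[OF assms(1,2) refl]]
    unfolding prob_A freqs_prob_eq_word_prob[OF assms(1) refl] by metis
qed

text \<open>
The order patterns that refine the event that the value-ordered frequencies equal \<open>ns\<close>. All of
them are equally likely, so only their number and \<open>freqs_prob ns\<close> matter.
\<close>

definition patterns_with_freqs :: "nat list \<Rightarrow> nat list set" where
  "patterns_with_freqs ns = {w. set w = {0..<length ns} \<and> map (count_list w) [0..<length ns] = ns}"

lemma length_patterns_with_freqs:
  assumes "w \<in> patterns_with_freqs ns"
  shows "length w = sum_list ns"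
proof -
  have "sum_list (map (count_list w) [0..<length ns]) = length w"
  proof -
    have "set w = {0..<length ns}" using assms by (simp add: patterns_with_freqs_def)
    then show ?thesis
      using sum_count_set[of w "set w"] by (simp add: sum_list_distinct_conv_sum_set)
  qed
  then show ?thesis using assms by (simp add: patterns_with_freqs_def)
qed

lemma finite_patterns_with_freqs: "finite (patterns_with_freqs ns)"
  by (rule finite_subset[OF _ finite_lists_length_eq[of "{0..<length ns}" "sum_list ns"]])
    (auto simp: length_patterns_with_freqs, auto simp: patterns_with_freqs_def)

lemma value_ordered_freqs_eq_iff:
  "value_ordered_freqs xs = ns \<longleftrightarrow> pattern xs \<in> patterns_with_freqs ns"
proof -
  have v: "value_ordered_freqs xs = map (count_list (pattern xs)) [0..<card (set xs)]"
    using value_ordered_freqs_interval[OF set_pattern[of xs]] value_ordered_freqs_pattern by simp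
  show ?thesis
  proof
    assume ns: "value_ordered_freqs xs = ns"
    then have "length ns = card (set xs)" unfolding v by (metis diff_zero length_map length_upt)
    then show "pattern xs \<in> patterns_with_freqs ns"
      using ns v set_pattern[of xs] by (simp add: patterns_with_freqs_def)
  next
    assume "pattern xs \<in> patterns_with_freqs ns"
    then have *: "set (pattern xs) = {0..<length ns}" "map (count_list (pattern xs)) [0..<length
      ns] = ns"
      by (simp_all only: patterns_with_freqs_def mem_Collect_eq)
    then have "length ns = card (set xs)"
      using set_pattern[of xs] by (metis card_atLeastLessThan diff_zero)
    then show "value_ordered_freqs xs = ns" using v *(2) by (simp only:)
  qed
qed

lemma prob_pattern_family:
  assumes ns: "ns' \<in> compositions" and inj: "inj_on g (patterns_with_freqs ns)"
    and g: "\<And>w. w \<in> patterns_with_freqs ns \<Longrightarrow> g w \<in> patterns_with_freqs ns'"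
  shows "prob {\<omega> \<in> space M. \<exists>w\<in>patterns_with_freqs ns. pattern (sample X (sum_list ns') \<omega>) = g w} =
    real (card (patterns_with_freqs ns)) * freqs_prob ns'"
proof -
  let ?n = "sum_list ns'"
  have "{\<omega> \<in> space M. \<exists>w\<in>patterns_with_freqs ns. pattern (sample X ?n \<omega>) = g w} =
    (\<Union>w\<in>patterns_with_freqs ns. {\<omega> \<in> space M. pattern (sample X ?n \<omega>) = g w})" by auto
  also have "prob \<dots> = (\<Sum>w\<in>patterns_with_freqs ns. prob {\<omega> \<in> space M. pattern (sample X ?n \<omega>) =
    g w})"
    by (rule finite_measure_finite_Union[OF finite_patterns_with_freqs])
      (use inj in \<open>auto simp: disjoint_family_on_def inj_on_def\<close>)
  also have "\<dots> = (\<Sum>w\<in>patterns_with_freqs ns. freqs_prob ns')"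
  proof (rule sum.cong[OF refl])
    fix w assume "w \<in> patterns_with_freqs ns"
    from g[OF this] have gw: "g w \<in> patterns_with_freqs ns'" .
    then have "set (g w) = {0..<length ns'}" "map (count_list (g w)) [0..<length ns'] = ns'"
      by (auto simp: patterns_with_freqs_def)
    moreover have "0 < length ns'" using ns by (simp add: compositions_def)
    ultimately show "prob {\<omega> \<in> space M. pattern (sample X ?n \<omega>) = g w} = freqs_prob ns'"
      using prob_pattern_sample[of "g w" "length ns'" ?n] length_patterns_with_freqs[OF gw] by simp
  qed
  finally show ?thesis by simp
qed

lemma prob_value_ordered_freqs:
  assumes "ns \<in> compositions"
  shows "prob {\<omega> \<in> space M. value_ordered_freqs (sample X (sum_list ns) \<omega>) = ns} =
    real (card (patterns_with_freqs ns)) * freqs_prob ns"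
  using prob_pattern_family[OF assms, of id ns] by (simp add: value_ordered_freqs_eq_iff)

lemma card_patterns_with_freqs_pos:
  assumes "ns \<in> compositions"
  shows "0 < card (patterns_with_freqs ns)"
proof -
  have "patterns_with_freqs ns \<noteq> {}"
    using exists_pattern_with_freqs[of ns] assms
      by (auto simp: patterns_with_freqs_def compositions_def)
  then show ?thesis using finite_patterns_with_freqs by (simp add: card_gt_0_iff)
qed

text \<open>
Given the pattern of the first \<open>n\<close> values, the event in question fixes the pattern of the first
\<open>n + 1\<close> values. So both probabilities in the quotient are multiples of the same number of
patterns.
\<close>

lemma cond_prob_freqs:
  assumes ns: "ns \<in> compositions" and ns': "ns' \<in> compositions" "sum_list ns' = Suc (sum_list ns)"
    and inj: "inj_on g (patterns_with_freqs ns)"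
    and g: "\<And>w. w \<in> patterns_with_freqs ns \<Longrightarrow> g w \<in> patterns_with_freqs ns'"
    and Q: "\<And>w \<omega>. w \<in> patterns_with_freqs ns \<Longrightarrow>
      pattern (sample X (sum_list ns) \<omega>) = w \<and> Q \<omega> \<longleftrightarrow> pattern (sample X (Suc (sum_list ns)) \<omega>) = g w"
    and q: "freqs_prob ns' = freqs_prob ns * q"
  shows "\<P>(\<omega> in M. Q \<omega> \<bar> value_ordered_freqs (sample X (sum_list ns) \<omega>) = ns) = q"
proof -
  let ?W = "patterns_with_freqs ns"
  have "Q \<omega> \<and> pattern (sample X (sum_list ns) \<omega>) \<in> ?W \<longleftrightarrow>
      (\<exists>w\<in>?W. pattern (sample X (Suc (sum_list ns)) \<omega>) = g w)" for \<omega>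
    using Q[of _ \<omega>] by metis
  then have "{\<omega> \<in> space M. Q \<omega> \<and> value_ordered_freqs (sample X (sum_list ns) \<omega>) = ns} =
    {\<omega> \<in> space M. \<exists>w\<in>?W. pattern (sample X (sum_list ns') \<omega>) = g w}"
    unfolding value_ordered_freqs_eq_iff ns'(2) by (simp only:)
  then have "\<P>(\<omega> in M. Q \<omega> \<bar> value_ordered_freqs (sample X (sum_list ns) \<omega>) = ns) =
    (real (card ?W) * (freqs_prob ns * q)) / (real (card ?W) * freqs_prob ns)"
    unfolding cond_prob_def prob_value_ordered_freqs[OF ns]
      using prob_pattern_family[OF ns'(1) inj g] q by simp
  also have "\<dots> = q"
    using card_patterns_with_freqs_pos[OF ns] freqs_prob_pos[OF ns] by simp
  finally show ?thesis .
qed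


lemma new_value_iff_pattern:
  assumes "w \<in> patterns_with_freqs ns" "r \<le> length ns"
  shows "pattern (sample X n \<omega>) = w \<and> new_value_of_rank X n (Suc r) \<omega> \<longleftrightarrow>
    pattern (sample X (Suc n) \<omega>) = map (shift_from r) w @ [r]"
  using new_rank_iff_pattern[of w "length ns" r "sample X n \<omega>" "X (Suc n) \<omega>"] assms
  by (simp add: new_value_of_rank_def sample_Suc patterns_with_freqs_def)

lemma old_value_iff_pattern:
  assumes "w \<in> patterns_with_freqs ns" "r < length ns"
  shows "pattern (sample X n \<omega>) = w \<and> old_value_of_rank X n (Suc r) \<omega> \<longleftrightarrow>
    pattern (sample X (Suc n) \<omega>) = w @ [r]"
  using old_rank_iff_pattern[of w "length ns" r "sample X n \<omega>" "X (Suc n) \<omega>"] assms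
  by (simp add: old_value_of_rank_def sample_Suc patterns_with_freqs_def)

lemma insert_patterns_with_freqs:
  assumes "w \<in> patterns_with_freqs ns" "r \<le> length ns"
  shows "map (shift_from r) w @ [r] \<in> patterns_with_freqs (take r ns @ 1 # drop r ns)"
proof -
  have w: "set w = {0..<length ns}" "map (count_list w) [0..<length ns] = ns"
    using assms(1) by (auto simp: patterns_with_freqs_def)
  have "length (take r ns @ 1 # drop r ns) = Suc (length ns)" using assms(2) by simp
  then show ?thesis
    unfolding patterns_with_freqs_def mem_Collect_eq
    using map_count_list_insert[OF w(1) assms(2)] unfolding w(2) by simp
qed

lemma increment_patterns_with_freqs:
  assumes "w \<in> patterns_with_freqs ns" "r < length ns"
  shows "w @ [r] \<in> patterns_with_freqs (ns[r := ns ! r + 1])"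
proof -
  have w: "set w = {0..<length ns}" "ns = map (count_list w) [0..<length ns]"
    using assms(1) by (auto simp: patterns_with_freqs_def)
  show ?thesis
    unfolding patterns_with_freqs_def mem_Collect_eq length_list_update
    using map_count_list_increment[OF w(1) assms(2) w(2)] by blast
qed

lemma value_ordered_freqs_new:
  assumes "value_ordered_freqs (sample X n \<omega>) = ns" "r \<le>
    length ns" "new_value_of_rank X n (Suc r) \<omega>"
  shows "value_ordered_freqs (sample X (Suc n) \<omega>) = take r ns @ 1 # drop r ns"
proof -
  have "pattern (sample X n \<omega>) \<in> patterns_with_freqs ns"
    using assms(1) by (simp add: value_ordered_freqs_eq_iff)
  then show ?thesis
    using new_value_iff_pattern[of _ ns r n \<omega>] insert_patterns_with_freqs assms(2,3)
    by (metis value_ordered_freqs_eq_iff)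
qed

lemma value_ordered_freqs_old:
  assumes "value_ordered_freqs (sample X n \<omega>) =
    ns" "r < length ns" "old_value_of_rank X n (Suc r) \<omega>"
  shows "value_ordered_freqs (sample X (Suc n) \<omega>) = ns[r := ns ! r + 1]"
proof -
  have "pattern (sample X n \<omega>) \<in> patterns_with_freqs ns"
    using assms(1) by (simp add: value_ordered_freqs_eq_iff)
  then show ?thesis
    using old_value_iff_pattern[of _ ns r n \<omega>] increment_patterns_with_freqs assms(2,3)
    by (metis value_ordered_freqs_eq_iff)
qed

lemma cond_prob_new:
  assumes "ns \<in> compositions" "r \<le> length ns"
  shows "\<P>(\<omega> in M. new_value_of_rank X (sum_list ns) (Suc r) \<omega> \<bar> value_ordered_freqs (sample X
    (sum_list ns) \<omega>) = ns) =
    p_new V (length ns) (sum_list ns) * h \<alpha> (1 # drop r ns) * (\<Prod>i<r. 1 - h \<alpha> (1 # drop i ns))"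
proof (rule cond_prob_freqs[OF assms(1)])
  show "take r ns @ 1 # drop r ns \<in> compositions"
    using assms(1) by (auto simp: compositions_def dest: in_set_takeD in_set_dropD)
  have "sum_list (take r ns) + sum_list (drop r ns) = sum_list ns"
    by (metis append_take_drop_id sum_list_append)
  then show "sum_list (take r ns @ 1 # drop r ns) = Suc (sum_list ns)" by simp
  show "inj_on (\<lambda>w. map (shift_from r) w @ [r]) (patterns_with_freqs ns)"
    by (rule inj_onI) (simp add: inj_map_eq_map[OF inj_shift_from])
  show "map (shift_from r) w @ [r] \<in> patterns_with_freqs (take r ns @ 1 # drop r ns)"
    if "w \<in> patterns_with_freqs ns" for w
    using that assms(2) by (rule insert_patterns_with_freqs)
  show "pattern (sample X (sum_list ns) \<omega>) = w \<and> new_value_of_rank X (sum_list ns) (Suc r) \<omega> \<longleftrightarrow>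
      pattern (sample X (Suc (sum_list ns)) \<omega>) = map (shift_from r) w @ [r]"
    if "w \<in> patterns_with_freqs ns" for w \<omega>
    using that assms(2) by (rule new_value_iff_pattern)
qed (rule freqs_prob_insert[OF assms])

lemma cond_prob_old:
  assumes "ns \<in> compositions" "r < length ns"
  shows "\<P>(\<omega> in M. old_value_of_rank X (sum_list ns) (Suc r) \<omega> \<bar> value_ordered_freqs (sample X
    (sum_list ns) \<omega>) = ns) =
    (1 - p_new V (length ns) (sum_list ns)) * h \<alpha> ((ns ! r + 1) # drop (Suc r) ns) *
    (\<Prod>i<r. 1 - h \<alpha> ((ns ! i + 1) # drop (Suc i) ns))"
proof (rule cond_prob_freqs[OF assms(1)])
  show "ns[r := ns ! r + 1] \<in> compositions"
    using assms(1) by (auto simp: compositions_def dest!: subsetD[OF set_update_subset_insert])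
  have "sum_list ns = sum_list (take r ns @ ns ! r # drop (Suc r) ns)"
    using id_take_nth_drop[OF assms(2)] by simp
  then show "sum_list (ns[r := ns ! r + 1]) = Suc (sum_list ns)"
    unfolding upd_conv_take_nth_drop[OF assms(2)] by simp
  show "inj_on (\<lambda>w. w @ [r]) (patterns_with_freqs ns)" by (rule inj_onI) simp
  show "w @ [r] \<in> patterns_with_freqs (ns[r := ns ! r + 1])"
    if "w \<in> patterns_with_freqs ns" for w
    using that assms(2) by (rule increment_patterns_with_freqs)
  show "pattern (sample X (sum_list ns) \<omega>) = w \<and> old_value_of_rank X (sum_list ns) (Suc r) \<omega> \<longleftrightarrow>
      pattern (sample X (Suc (sum_list ns)) \<omega>) = w @ [r]"
    if "w \<in> patterns_with_freqs ns" for w \<omega>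
    using that assms(2) by (rule old_value_iff_pattern)
qed (rule freqs_prob_increment[OF assms])

end

section \<open>The value-ordered Chinese restaurant rule\<close>

theorem corollary3p3:
  fixes M :: "'a measure"
    and \<alpha> :: real
    and V :: "nat \<Rightarrow> nat \<Rightarrow> real"
    and R :: "nat \<Rightarrow> 'a \<Rightarrow> nat set set"
    and P :: "nat \<Rightarrow> 'a \<Rightarrow> real"
    and X :: "nat \<Rightarrow> 'a \<Rightarrow> nat"
    and n k :: nat
    and ns :: "nat list"
  assumes "prob_space M"
    and "0 \<le> \<alpha>" and "\<alpha> < 1"
    and "gibbs_partition M \<alpha> V R"
    and "size_biased_frequencies M R P"
    and "proper_frequencies M P"
    and "random_sample_from M P X"
    and "ns \<in> compositions" and "length ns = k" and "sum_list ns = n"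
  shows "(\<forall>j\<in>{1..k+1}.
           (\<forall>\<omega>\<in>space M.
              value_ordered_freqs (sample X n \<omega>) = ns \<longrightarrow> new_value_of_rank X n j \<omega> \<longrightarrow>
              value_ordered_freqs (sample X (n + 1) \<omega>) = take (j - 1) ns @ 1 # drop (j - 1) ns) \<and>
           \<P>(\<omega> in M. new_value_of_rank X n j \<omega> \<bar> value_ordered_freqs (sample X n \<omega>) = ns) =
             p_new V k n * h \<alpha> (1 # drop (j - 1) ns) *
             (\<Prod>i=1..j-1. 1 - h \<alpha> (1 # drop (i - 1) ns)))
       \<and> (\<forall>j\<in>{1..k}.
           (\<forall>\<omega>\<in>space M.
              value_ordered_freqs (sample X n \<omega>) = ns \<longrightarrow> old_value_of_rank X n j \<omega> \<longrightarrow>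
              value_ordered_freqs (sample X (n + 1) \<omega>) = ns[j - 1 := ns ! (j - 1) + 1]) \<and>
           \<P>(\<omega> in M. old_value_of_rank X n j \<omega> \<bar> value_ordered_freqs (sample X n \<omega>) = ns) =
             (1 - p_new V k n) * h \<alpha> ((ns ! (j - 1) + 1) # drop j ns) *
             (\<Prod>i=1..j-1. 1 - h \<alpha> ((ns ! (i - 1) + 1) # drop i ns)))"
proof -
  interpret prob_space M by (rule assms(1))
  interpret gibbs_sample M \<alpha> V R P X
    by unfold_locales (use assms in \<open>auto simp: gibbs_partition_def\<close>)
  have k: "k = length ns" and n: "n = sum_list ns" using assms by auto
  have new: "(\<forall>\<omega>\<in>space M.
      value_ordered_freqs (sample X n \<omega>) = ns \<longrightarrow> new_value_of_rank X n j \<omega> \<longrightarrow>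
      value_ordered_freqs (sample X (n + 1) \<omega>) = take (j - 1) ns @ 1 # drop (j - 1) ns) \<and>
    \<P>(\<omega> in M. new_value_of_rank X n j \<omega> \<bar> value_ordered_freqs (sample X n \<omega>) = ns) =
      p_new V k n * h \<alpha> (1 # drop (j - 1) ns) *
      (\<Prod>i=1..j-1. 1 - h \<alpha> (1 # drop (i - 1) ns))"
    if j: "j \<in> {1..k+1}" for j
  proof -
    obtain r where r: "j = Suc r" "r \<le> length ns" using j k by (cases j) auto
    have "(\<Prod>i=1..j-1. 1 - h \<alpha> (1 # drop (i - 1) ns)) = (\<Prod>i<r. 1 - h \<alpha> (1 # drop i ns))"
      using r(1) by (simp add: prod.atLeast1_atMost_eq)
    then show ?thesis
      using value_ordered_freqs_new[OF _ r(2)] cond_prob_new[OF assms(8) r(2)]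
      by (simp add: r(1) k n)
  qed
  have old: "(\<forall>\<omega>\<in>space M.
      value_ordered_freqs (sample X n \<omega>) = ns \<longrightarrow> old_value_of_rank X n j \<omega> \<longrightarrow>
      value_ordered_freqs (sample X (n + 1) \<omega>) = ns[j - 1 := ns ! (j - 1) + 1]) \<and>
    \<P>(\<omega> in M. old_value_of_rank X n j \<omega> \<bar> value_ordered_freqs (sample X n \<omega>) = ns) =
      (1 - p_new V k n) * h \<alpha> ((ns ! (j - 1) + 1) # drop j ns) *
      (\<Prod>i=1..j-1. 1 - h \<alpha> ((ns ! (i - 1) + 1) # drop i ns))"
    if j: "j \<in> {1..k}" for j
  proof -
    obtain r where r: "j = Suc r" "r < length ns" using j k by (cases j) auto
    have "(\<Prod>i=1..j-1. 1 - h \<alpha> ((ns ! (i - 1) + 1) # drop i ns)) =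
        (\<Prod>i<r. 1 - h \<alpha> ((ns ! i + 1) # drop (Suc i) ns))"
      using r(1) by (simp add: prod.atLeast1_atMost_eq)
    then show ?thesis
      using value_ordered_freqs_old[OF _ r(2)] cond_prob_old[OF assms(8) r(2)]
      by (simp add: r(1) k n)
  qed
  show ?thesis using new old by blast
qed

end
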